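(* There is an absolute constant $c>0$ with the following property. For every $n\geq 1$ and every family $\mathcal{K}$ of $n$ convex sets in $\mathbb{R}^3$ such that any two sets $K_1,K_2\in\mathcal{K}$ satisfy $K_1\cap K_2\neq\emptyset$, there is a line in $\mathbb{R}^3$ intersecting at least $cn$ of the sets $K\in\mathcal{K}$. *)

theory Defs
  imports "HOL-Analysis.Analysis"
begin

end

theory Submission
  imports Defs
begin

text \<open>
  Choose points \<open>p\<^sub>i\<^sub>j\<close> in \<open>K\<^sub>i \<inter> K\<^sub>j\<close> and pass to homogeneous coordinates, so that lines of \<open>\<real>\<^sup>3\<close> become
  two-dimensional subspaces of \<open>\<real>\<^sup>4\<close>. After a small perturbation some linear map \<open>A\<close> puts the vectors in radial
  isotropic position (Forster, Barthe): the normalised images \<open>w\<^sub>i\<^sub>j\<close> satisfy \<open>\<Sum> \<langle>w\<^sub>i\<^sub>j, u\<rangle>\<^sup>2 = N/4\<close> for every unit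
  vector \<open>u\<close>, where \<open>N\<close> is the number of pairs.

  Call \<open>i\<close> thin if all triples \<open>w\<^sub>i\<^sub>j, w\<^sub>i\<^sub>k, w\<^sub>i\<^sub>l\<close> are nearly linearly dependent. By compactness, finitely many
  two-dimensional subspaces meet the cones of all indices that are not thin; so if a positive fraction of the
  indices is not thin, one of these subspaces gives the line.

  Otherwise almost every \<open>w\<^sub>i\<^sub>j\<close> lies close to both projective lines \<open>L\<^sub>i\<close> and \<open>L\<^sub>j\<close>. Pairwise meeting lines are
  coplanar or concurrent. Isotropy forbids that most of the \<open>w\<^sub>i\<^sub>j\<close> are close to a common hyperplane (it would
  carry more than \<open>3/4\<close> of the mass), so most of the \<open>L\<^sub>i\<close> pass through a common point \<open>q\<close>. Then \<open>w\<^sub>i\<^sub>j\<close> is close to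
  \<open>q\<close> unless \<open>L\<^sub>i\<close> and \<open>L\<^sub>j\<close> nearly coincide, and either \<open>q\<close> carries more than \<open>1/4\<close> of the mass or some line
  carries more than \<open>1/2\<close> of it. Letting the perturbation tend to zero gives the general case.
\<close>

subsection \<open>Thin isotropic systems do not exist\<close>

text \<open>The inner product of the trivectors of \<open>x, y, z\<close> and
  \<open>a, b, c\<close>. Its supremum over unit \<open>a, b, c\<close> is the volume spanned by
  \<open>x, y, z\<close>, so smallness for all unit \<open>a, b, c\<close> expresses near linear
  dependence.\<close>

definition tri_det :: "'a::real_inner \<Rightarrow> 'a \<Rightarrow> 'a \<Rightarrow> 'a \<Rightarrow> 'a \<Rightarrow> 'a \<Rightarrow> real" where
  "tri_det x y z a b c =
     (x \<bullet> a) * ((y \<bullet> b) * (z \<bullet> c) - (y \<bullet> c) * (z \<bullet> b))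
   - (x \<bullet> b) * ((y \<bullet> a) * (z \<bullet> c) - (y \<bullet> c) * (z \<bullet> a))
   + (x \<bullet> c) * ((y \<bullet> a) * (z \<bullet> b) - (y \<bullet> b) * (z \<bullet> a))"

lemma abs_inner_le_1:
  fixes x y :: "'a::real_inner"
  assumes "norm x \<le> 1" "norm y \<le> 1"
  shows "\<bar>x \<bullet> y\<bar> \<le> 1"
  using Cauchy_Schwarz_ineq2[of x y] mult_mono[of "norm x" 1 "norm y" 1] assms by simp

lemma abs_minor_le_2:
  fixes p q r s :: real
  assumes "\<bar>p\<bar> \<le> 1" "\<bar>q\<bar> \<le> 1" "\<bar>r\<bar> \<le> 1" "\<bar>s\<bar> \<le> 1"
  shows "\<bar>p * q - r * s\<bar> \<le> 2"
proof -
  have "\<bar>p * q\<bar> \<le> 1" "\<bar>r * s\<bar> \<le> 1"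
    using assms by (simp_all add: abs_mult mult_le_one)
  then show ?thesis by linarith
qed

lemma abs_mult_le_double:
  fixes p q :: real
  assumes "\<bar>q\<bar> \<le> 2"
  shows "\<bar>p * q\<bar> \<le> 2 * \<bar>p\<bar>"
  using mult_left_mono[OF assms, of "\<bar>p\<bar>"] by (simp add: abs_mult mult.commute)

text \<open>Expansion along the row of \<open>x\<close>, whose other two minors are at most 2 in
  absolute value. It applies when \<open>x\<close> is almost orthogonal to \<open>b\<close> and
  \<open>c\<close>.\<close>

lemma tri_det_row:
  fixes x y z a b c :: "'a::real_inner"
  assumes "norm y \<le> 1" "norm z \<le> 1" "norm a \<le> 1" "norm b \<le> 1" "norm c \<le> 1"
  shows "\<bar>x \<bullet> a\<bar> * \<bar>(y \<bullet> b) * (z \<bullet> c) - (y \<bullet> c) * (z \<bullet> b)\<bar>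
           \<le> \<bar>tri_det x y z a b c\<bar> + 2 * \<bar>x \<bullet> b\<bar> + 2 * \<bar>x \<bullet> c\<bar>"
proof -
  have "\<bar>(x \<bullet> b) * ((y \<bullet> a) * (z \<bullet> c) - (y \<bullet> c) * (z \<bullet> a))\<bar> \<le> 2 * \<bar>x \<bullet> b\<bar>"
       "\<bar>(x \<bullet> c) * ((y \<bullet> a) * (z \<bullet> b) - (y \<bullet> b) * (z \<bullet> a))\<bar> \<le> 2 * \<bar>x \<bullet> c\<bar>"
    by (intro abs_mult_le_double abs_minor_le_2 abs_inner_le_1 assms)+
  then show ?thesis
    unfolding abs_mult[symmetric] tri_det_def by linarith
qed

text \<open>Expansion along the column of \<open>a\<close>. It applies when \<open>y\<close> and
  \<open>z\<close> almost lie in the hyperplane orthogonal to \<open>a\<close> and \<open>x\<close>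
  does not: then the minor must be small.\<close>

lemma tri_det_column:
  fixes x y z a b c :: "'a::real_inner"
  assumes "norm x \<le> 1" "norm y \<le> 1" "norm z \<le> 1" "norm b \<le> 1" "norm c \<le> 1"
  shows "\<bar>x \<bullet> a\<bar> * \<bar>(y \<bullet> b) * (z \<bullet> c) - (y \<bullet> c) * (z \<bullet> b)\<bar>
           \<le> \<bar>tri_det x y z a b c\<bar> + 2 * \<bar>y \<bullet> a\<bar> + 2 * \<bar>z \<bullet> a\<bar>"
proof -
  have "\<bar>(y \<bullet> a) * ((x \<bullet> b) * (z \<bullet> c) - (x \<bullet> c) * (z \<bullet> b))\<bar> \<le> 2 * \<bar>y \<bullet> a\<bar>"
       "\<bar>(z \<bullet> a) * ((x \<bullet> b) * (y \<bullet> c) - (x \<bullet> c) * (y \<bullet> b))\<bar> \<le> 2 * \<bar>z \<bullet> a\<bar>"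
    by (intro abs_mult_le_double abs_minor_le_2 abs_inner_le_1 assms)+
  moreover have "(x \<bullet> a) * ((y \<bullet> b) * (z \<bullet> c) - (y \<bullet> c) * (z \<bullet> b)) = tri_det x y z a b c
      + (y \<bullet> a) * ((x \<bullet> b) * (z \<bullet> c) - (x \<bullet> c) * (z \<bullet> b))
      - (z \<bullet> a) * ((x \<bullet> b) * (y \<bullet> c) - (x \<bullet> c) * (y \<bullet> b))"
    unfolding tri_det_def by algebra
  ultimately show ?thesis
    unfolding abs_mult[symmetric] by linarith
qed

section \<open>Orthonormal systems in four-dimensional space\<close>

lemma unit_orthogonal_to_three:
  fixes a b c :: "real^4"
  obtains d where "norm d = 1" "d \<bullet> a = 0" "d \<bullet> b = 0" "d \<bullet> c = 0"
proof -
  have "dim {a, b, c} \<le> card {a, b, c}"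
    by (intro dim_le_card) (auto simp: span_base)
  also have "\<dots> \<le> 3"
    by (simp add: card_insert_if)
  finally have "dim {a, b, c} < DIM(real^4)"
    by simp
  then obtain x where x: "x \<noteq> 0" "\<And>y. y \<in> span {a, b, c} \<Longrightarrow> orthogonal x y"
    using orthogonal_to_subspace_exists by blast
  have "x \<bullet> a = 0" "x \<bullet> b = 0" "x \<bullet> c = 0"
    using x(2) by (simp_all add: orthogonal_def span_base)
  then show ?thesis
    using that[of "x /\<^sub>R norm x"] x(1) by simp
qed

lemma orthonormal_pair_orthogonal_to:
  fixes a b :: "real^4"
  obtains c d where "norm c = 1" "norm d = 1" "c \<bullet> d = 0" 
    "c \<bullet> a = 0" "c \<bullet> b = 0" "d \<bullet> a = 0" "d \<bullet> b = 0"
proof -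
  obtain c where "norm c = 1" "c \<bullet> a = 0" "c \<bullet> b = 0"
    using unit_orthogonal_to_three[of a b b] by blast
  moreover obtain d where "norm d = 1" "d \<bullet> a = 0" "d \<bullet> b = 0" "d \<bullet> c = 0"
    using unit_orthogonal_to_three[of a b c] by blast
  ultimately show ?thesis
    using that[of c d] by (simp add: inner_commute)
qed

text \<open>A nonzero remainder orthogonal to the four vectors would give five independent vectors
  in dimension four.\<close>

lemma parseval_4:
  fixes x q r b c :: "real^4"
  assumes n: "norm q = 1" "norm r = 1" "norm b = 1" "norm c = 1"
    and o: "q \<bullet> r = 0" "q \<bullet> b = 0" "q \<bullet> c = 0" "r \<bullet> b = 0" "r \<bullet> c = 0" "b \<bullet> c = 0"
  shows "(norm x)\<^sup>2 = (x \<bullet> q)\<^sup>2 + (x \<bullet> r)\<^sup>2 + (x \<bullet> b)\<^sup>2 + (x \<bullet> c)\<^sup>2"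
proof -
  have i: "q \<bullet> q = 1" "r \<bullet> r = 1" "b \<bullet> b = 1" "c \<bullet> c = 1"
    using n by (simp_all add: dot_square_norm)
  have o': "r \<bullet> q = 0" "b \<bullet> q = 0" "c \<bullet> q = 0" "b \<bullet> r = 0" "c \<bullet> r = 0" "c \<bullet> b = 0"
    using o by (simp_all add: inner_commute)
  define y where "y = x - (x \<bullet> q) *\<^sub>R q - (x \<bullet> r) *\<^sub>R r - (x \<bullet> b) *\<^sub>R b - (x \<bullet> c) *\<^sub>R c"
  have y: "y \<bullet> q = 0" "y \<bullet> r = 0" "y \<bullet> b = 0" "y \<bullet> c = 0"
    unfolding y_def by (simp_all add: inner_diff_left i o o')
  have "y = 0"
  proof (rule ccontr)
    assume "y \<noteq> 0"
    have ne: "q \<noteq> r" "q \<noteq> b" "q \<noteq> c" "r \<noteq> b" "r \<noteq> c" "b \<noteq> c" "y \<noteq> q" "y \<noteq> r" "y \<noteq> b" "y \<noteq> c"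
      using i o y by auto
    have "pairwise orthogonal {y, q, r, b, c}"
      using y o o' by (auto simp: pairwise_def orthogonal_def inner_commute)
    moreover have "0 \<notin> {y, q, r, b, c}"
      using \<open>y \<noteq> 0\<close> i by auto
    ultimately have "independent {y, q, r, b, c}"
      by (rule pairwise_orthogonal_independent)
    then have "card {y, q, r, b, c} \<le> DIM(real^4)"
      using independent_bound by blast
    then show False
      using ne by simp
  qed
  then have "x = (x \<bullet> q) *\<^sub>R q + (x \<bullet> r) *\<^sub>R r + (x \<bullet> b) *\<^sub>R b + (x \<bullet> c) *\<^sub>R c"
    unfolding y_def by (simp add: algebra_simps)
  then have "x \<bullet> x = x \<bullet> ((x \<bullet> q) *\<^sub>R q + (x \<bullet> r) *\<^sub>R r + (x \<bullet> b) *\<^sub>R b + (x \<bullet> c) *\<^sub>R c)"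
    by simp
  then show ?thesis
    unfolding power2_norm_eq_inner by (simp add: inner_add_right power2_eq_square)
qed

text \<open>Exact isotropy would give \<open>1/4\<close> in the last assumption below; the slack absorbs the diagonal and the
  pairs involving one of the few indices outside \<open>G\<close>, whose vectors are replaced by \<open>0\<close>.\<close>

locale thin_isotropic_system =
  fixes n :: nat and G :: "nat set" and w :: "nat \<Rightarrow> nat \<Rightarrow> real^4"
  assumes n_large: "1000 \<le> n"
    and G_subset: "G \<subseteq> {..<n}"
    and sym: "w i j = w j i"
    and unit: "\<lbrakk>i \<in> G; j \<in> G; i \<noteq> j\<rbrakk> \<Longrightarrow> norm (w i j) = 1"
    and zero: "i \<notin> G \<or> j \<notin> G \<or> i = j \<Longrightarrow> w i j = 0"
    and thin: "\<lbrakk>i \<in> G; norm a = 1; norm b = 1; norm c = 1\<rbrakk>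
                 \<Longrightarrow> \<bar>tri_det (w i j) (w i k) (w i l) a b c\<bar> \<le> 1 / 10^18"
    and iso: "norm u = 1 \<Longrightarrow> 249/1000 * (real n)\<^sup>2 \<le> (\<Sum>i<n. \<Sum>j<n. (w i j \<bullet> u)\<^sup>2)"
begin

section \<open>Consequences of thinness and isotropy\<close>

lemma norm_le_1: "norm (w i j) \<le> 1"
  by (metis norm_zero unit zero zero_le_one order_refl)

lemma nonzero_unit: "w i j \<noteq> 0 \<Longrightarrow> norm (w i j) = 1 \<and> i \<in> G \<and> j \<in> G \<and> i \<noteq> j"
  using unit zero by blast

lemma sq_inner_le_1: "norm u = 1 \<Longrightarrow> (w i j \<bullet> u)\<^sup>2 \<le> 1"
  using abs_inner_le_1[of "w i j" u] norm_le_1[of i j] by (simp add: abs_square_le_1)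

text \<open>The span of \<open>a\<close> and \<open>b\<close> is the approximate projective line of
  the index \<open>i\<close>. It is generated by one vector of the star of \<open>i\<close> and by
  the largest component orthogonal to it.\<close>

lemma near_plane:
  obtains a b where "\<And>l c. \<lbrakk>norm c = 1; c \<bullet> a = 0; c \<bullet> b = 0\<rbrakk> \<Longrightarrow> \<bar>w i l \<bullet> c\<bar> \<le> 1 / 10^9"
proof (cases "\<forall>l. w i l = 0")
  case True
  then show ?thesis using that[of 0 0] by simp
next
  case False
  then obtain l0 where "w i l0 \<noteq> 0" by blast
  then have i: "i \<in> G" and u0: "norm (w i l0) = 1"
    using nonzero_unit by blast+
  define x where "x = w i l0"
  have xx: "x \<bullet> x = 1" using u0 by (simp add: x_def dot_square_norm)
  define g where "g l = w i l - (w i l \<bullet> x) *\<^sub>R x" for l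
  have gx: "g l \<bullet> x = 0" for l
    by (simp add: g_def inner_diff_left xx)
  have "finite ((\<lambda>l. norm (g l)) ` {..<n})" "(\<lambda>l. norm (g l)) ` {..<n} \<noteq> {}"
    using n_large by (auto simp: lessThan_empty_iff)
  then have "Max ((\<lambda>l. norm (g l)) ` {..<n}) \<in> (\<lambda>l. norm (g l)) ` {..<n}"
    by (rule Max_in)
  then obtain m where m: "m < n" "norm (g m) = Max ((\<lambda>l. norm (g l)) ` {..<n})"
    by auto
  have le: "norm (g l) \<le> norm (g m)" for l
  proof (cases "l < n")
    case True
    then show ?thesis by (simp add: m(2))
  next
    case False
    then have "w i l = 0" using zero G_subset by blast
    then show ?thesis by (simp add: g_def)
  qed
  have wc: "w i l \<bullet> c = g l \<bullet> c" if "c \<bullet> x = 0" for l c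
    using that by (simp add: g_def inner_diff_left inner_commute[of x c])
  show ?thesis
  \<comment> \<open>The threshold is the square root of the thinness bound: below it the star is
    close to the line through \<open>x\<close> alone, above it division by \<open>\<mu>\<close>
    still leaves at most \<open>1 / 10^9\<close>.\<close>
  proof (cases "norm (g m) \<le> 1 / 10^9")
    case True
    show ?thesis
    proof (rule that[of x x])
      fix l c assume c: "norm c = 1" "c \<bullet> x = 0"
      have "\<bar>w i l \<bullet> c\<bar> \<le> norm (g l) * norm c"
        unfolding wc[OF c(2)] by (rule Cauchy_Schwarz_ineq2)
      then show "\<bar>w i l \<bullet> c\<bar> \<le> 1 / 10^9"
        using c(1) le[of l] True by simp
    qed
  next
    case False
    define \<mu> where "\<mu> = norm (g m)"
    have \<mu>: "\<mu> > 1 / 10^9" using False by (simp add: \<mu>_def)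
    have \<mu>0: "\<mu> > 0" by (rule less_trans[OF _ \<mu>]) simp
    define r where "r = g m /\<^sub>R \<mu>"
    have r: "norm r = 1" "r \<bullet> x = 0"
      using \<mu>0 by (simp_all add: r_def \<mu>_def gx)
    show ?thesis
    proof (rule that[of x "g m"])
      fix l c assume c: "norm c = 1" "c \<bullet> x = 0" "c \<bullet> g m = 0"
      have 1: "w i m \<bullet> r = \<mu>"
        unfolding wc[OF r(2)] using \<mu>0 by (simp add: r_def \<mu>_def dot_square_norm power2_eq_square)
      have 2: "w i m \<bullet> c = 0"
        unfolding wc[OF c(2)] using c(3) by (simp add: inner_commute)
      \<comment> \<open>The matrix is lower triangular with diagonal \<open>1\<close>,
        \<open>\<mu>\<close>, \<open>w i l \<bullet> c\<close>.\<close>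
      have "tri_det (w i l0) (w i m) (w i l) x r c = \<mu> * (w i l \<bullet> c)"
        using xx r c 1 2 by (simp add: tri_det_def x_def[symmetric] inner_commute)
      then have "\<mu> * \<bar>w i l \<bullet> c\<bar> \<le> 1 / 10^18"
        using thin[OF i, of x r c l0 m l] u0 r c \<mu>0 by (simp add: x_def abs_mult)
      moreover have "(1 / 10^9) * \<bar>w i l \<bullet> c\<bar> \<le> \<mu> * \<bar>w i l \<bullet> c\<bar>"
        using \<mu> by (intro mult_right_mono) auto
      ultimately show "\<bar>w i l \<bullet> c\<bar> \<le> 1 / 10^9"
        by simp
    qed
  qed
qed

lemma thin_row:
  assumes "i \<in> G" "norm a = 1" "norm b = 1" "norm c = 1"
  shows "\<bar>w i j \<bullet> a\<bar> * \<bar>(w i k \<bullet> b) * (w i l \<bullet> c) - (w i k \<bullet> c) * (w i l \<bullet> b)\<bar>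
           \<le> 1 / 10^18 + 2 * \<bar>w i j \<bullet> b\<bar> + 2 * \<bar>w i j \<bullet> c\<bar>"
  using tri_det_row[of "w i k" "w i l" a b c "w i j"] thin[of i a b c j k l] norm_le_1 assms
  by fastforce

lemma thin_column:
  assumes "i \<in> G" "norm a = 1" "norm b = 1" "norm c = 1"
  shows "\<bar>w i j \<bullet> a\<bar> * \<bar>(w i k \<bullet> b) * (w i l \<bullet> c) - (w i k \<bullet> c) * (w i l \<bullet> b)\<bar>
           \<le> 1 / 10^18 + 2 * \<bar>w i k \<bullet> a\<bar> + 2 * \<bar>w i l \<bullet> a\<bar>"
  using tri_det_column[of "w i j" "w i k" "w i l" b c a] thin[of i a b c j k l] norm_le_1 assms
  by fastforce

lemma iso_pair:
  assumes "norm c = 1" "norm d = 1"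
  shows "498/1000 * (real n)\<^sup>2 \<le> (\<Sum>i<n. \<Sum>j<n. (w i j \<bullet> c)\<^sup>2 + (w i j \<bullet> d)\<^sup>2)"
  using iso[OF assms(1)] iso[OF assms(2)] by (simp add: sum.distrib)

text \<open>The total mass is at most that of all \<open>n * n\<close> unit vectors, and the three
  directions completing \<open>q\<close> to an orthonormal basis take at least
  \<open>747/1000\<close> of it.\<close>

lemma iso_upper:
  assumes "norm q = 1"
  shows "(\<Sum>i<n. \<Sum>j<n. (w i j \<bullet> q)\<^sup>2) \<le> 253/1000 * (real n)\<^sup>2"
proof -
  obtain b c where bc: "norm b = 1" "norm c = 1" "b \<bullet> c = 0" "b \<bullet> q = 0" "c \<bullet> q = 0"
    using orthonormal_pair_orthogonal_to[of q q] by blast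
  obtain d where d: "norm d = 1" "d \<bullet> q = 0" "d \<bullet> b = 0" "d \<bullet> c = 0"
    using unit_orthogonal_to_three[of q b c] by blast
  have "(\<Sum>i<n. \<Sum>j<n. (w i j \<bullet> q)\<^sup>2) + (\<Sum>i<n. \<Sum>j<n. (w i j \<bullet> b)\<^sup>2) + (\<Sum>i<n. \<Sum>j<n. (w i j \<bullet> c)\<^sup>2)
      + (\<Sum>i<n. \<Sum>j<n. (w i j \<bullet> d)\<^sup>2) = (\<Sum>i<n. \<Sum>j<n. (norm (w i j))\<^sup>2)"
    unfolding sum.distrib[symmetric]
    by (intro sum.cong refl parseval_4[symmetric]) (use assms bc d in \<open>simp_all add: inner_commute\<close>)
  also have "\<dots> \<le> (\<Sum>i<n. \<Sum>j<n. 1)"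
    by (intro sum_mono) (simp add: norm_le_1 power_le_one)
  also have "\<dots> = (real n)\<^sup>2"
    by (simp add: power2_eq_square)
  finally show ?thesis
    using iso[OF bc(1)] iso[OF bc(2)] iso[OF d(1)] by linarith
qed

text \<open>Pairs touching \<open>D\<close> contribute almost nothing in the directions
  \<open>b\<close> and \<open>c\<close>, so almost half of the mass must come from pairs avoiding
  \<open>D\<close>. With more than \<open>3/10 * n\<close> indices in \<open>D\<close>, fewer than
  \<open>49/100\<close> of the pairs would be left for that.\<close>

lemma not_near_line:
  assumes b: "norm b = 1" "norm c = 1"
    and D: "D \<subseteq> {..<n}" "\<And>l k. l \<in> D \<Longrightarrow> \<bar>w l k \<bullet> b\<bar> \<le> 1/100 \<and> \<bar>w l k \<bullet> c\<bar> \<le> 1/100"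
    and bc: "b \<bullet> c = 0"
  shows "real (card D) \<le> 3/10 * n"
proof -
  have fD: "finite D" using D(1) finite_subset by blast
  have le1: "(w i j \<bullet> b)\<^sup>2 + (w i j \<bullet> c)\<^sup>2 \<le> 1" for i j
  proof -
    obtain q r where qr: "norm q = 1" "norm r = 1" "q \<bullet> r = 0" "q \<bullet> b = 0" "q \<bullet> c = 0" "r \<bullet> b = 0" "r \<bullet> c = 0"
      using orthonormal_pair_orthogonal_to[of b c] by blast
    have "(norm (w i j))\<^sup>2 = (w i j \<bullet> q)\<^sup>2 + (w i j \<bullet> r)\<^sup>2 + (w i j \<bullet> b)\<^sup>2 + (w i j \<bullet> c)\<^sup>2"
      by (intro parseval_4 qr b bc)
    moreover have "(norm (w i j))\<^sup>2 \<le> 1" by (simp add: norm_le_1 power_le_one)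
    ultimately show ?thesis
      using zero_le_power2[of "w i j \<bullet> q"] zero_le_power2[of "w i j \<bullet> r"] by linarith
  qed
  have small: "(w l k \<bullet> b)\<^sup>2 + (w l k \<bullet> c)\<^sup>2 \<le> 2/10000" if "l \<in> D \<or> k \<in> D" for l k
  proof -
    have "\<bar>w l k \<bullet> b\<bar> \<le> 1/100" "\<bar>w l k \<bullet> c\<bar> \<le> 1/100"
      using that D(2) sym by metis+
    then have "(w l k \<bullet> b)\<^sup>2 \<le> (1/100)\<^sup>2" "(w l k \<bullet> c)\<^sup>2 \<le> (1/100)\<^sup>2"
      by (metis abs_ge_zero power2_abs power_mono)+
    then show ?thesis by (simp add: power2_eq_square)
  qed
  let ?f = "\<lambda>i j. (w i j \<bullet> b)\<^sup>2 + (w i j \<bullet> c)\<^sup>2"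
  define ind :: "nat \<Rightarrow> real" where "ind i = (if i \<in> D then 0 else 1)" for i
  have "?f i j \<le> 2/10000 + ind i * ind j" for i j
    using le1[of i j] small[of i j] by (auto simp: ind_def)
  then have "(\<Sum>i<n. \<Sum>j<n. ?f i j) \<le> (\<Sum>i<n. \<Sum>j<n. 2/10000 + ind i * ind j)"
    by (intro sum_mono)
  also have "\<dots> = 2/10000 * (real n)\<^sup>2 + (\<Sum>i<n. ind i)\<^sup>2"
    by (simp add: sum.distrib sum_product power2_eq_square)
  also have "(\<Sum>i<n. ind i) = real (card ({..<n} - D))"
    unfolding ind_def by (simp add: sum.If_cases Diff_eq)
  also have "\<dots> = real n - real (card D)"
    using D(1) fD by (simp add: card_Diff_subset card_mono[of "{..<n}" D, simplified] of_nat_diff)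
  finally have *: "498/1000 * (real n)\<^sup>2 \<le> 2/10000 * (real n)\<^sup>2 + (real n - real (card D))\<^sup>2"
    using iso_pair[OF b] by linarith
  show ?thesis
  proof (rule ccontr)
    assume "\<not> ?thesis"
    moreover have "real (card D) \<le> real n"
      using card_mono[of "{..<n}" D] D(1) by simp
    ultimately have "(real n - real (card D))\<^sup>2 \<le> (7/10 * real n)\<^sup>2"
      by (intro power_mono) auto
    also have "\<dots> = 49/100 * (real n)\<^sup>2"
      by (simp add: power2_eq_square)
    finally have "498/1000 * (real n)\<^sup>2 \<le> 2/10000 * (real n)\<^sup>2 + 49/100 * (real n)\<^sup>2"
      using * by linarith
    then show False
      using n_large by (simp add: power2_eq_square)
  qed
qed

lemma G_nonempty: "\<exists>i. i \<in> G"
proof (rule ccontr)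
  assume "\<not> ?thesis"
  then have "w i j = 0" for i j using zero by blast
  then have "249/1000 * (real n)\<^sup>2 \<le> 0"
    using iso[of "axis 1 1"] by (simp add: norm_axis_1)
  then show False
    using n_large by (simp add: power2_eq_square mult_le_0_iff)
qed

text \<open>Projectively, \<open>q\<close> is the meeting point of the lines of \<open>i\<close> and
  \<open>j\<close>, the hyperplane orthogonal to \<open>\<nu>\<close> is spanned by these lines,
  \<open>R\<close> collects the indices whose lines leave it, and \<open>D m\<close> those lines of
  \<open>R\<close> that nearly coincide with the line of \<open>m\<close>.\<close>

lemma contradiction: False
proof -
  obtain i where i: "i \<in> G" using G_nonempty by blast
  obtain a b where ab: "\<And>l c. \<lbrakk>norm c = 1; c \<bullet> a = 0; c \<bullet> b = 0\<rbrakk> \<Longrightarrow> \<bar>w i l \<bullet> c\<bar> \<le> 1 / 10^9"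
    using near_plane[of i] by blast
  obtain c d where cd: "norm c = 1" "norm d = 1" "c \<bullet> d = 0" "c \<bullet> a = 0" "c \<bullet> b = 0" "d \<bullet> a = 0" "d \<bullet> b = 0"
    using orthonormal_pair_orthogonal_to by blast
  have cc: "c \<bullet> c = 1" "d \<bullet> d = 1" "d \<bullet> c = 0"
    using cd by (simp_all add: dot_square_norm inner_commute)
  \<comment> \<open>Otherwise the directions \<open>c\<close> and \<open>d\<close> would carry at
    most a quarter of the mass, where isotropy demands almost half.\<close>
  have "\<exists>j k. (w j k \<bullet> c)\<^sup>2 + (w j k \<bullet> d)\<^sup>2 \<ge> 1/4"
  proof (rule ccontr)
    assume "\<not> ?thesis"
    then have "(\<Sum>i<n. \<Sum>j<n. (w i j \<bullet> c)\<^sup>2 + (w i j \<bullet> d)\<^sup>2) \<le> (\<Sum>i<n. \<Sum>j<n. 1/4)"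
      by (intro sum_mono) (meson less_eq_real_def linorder_not_less)
    then have "498/1000 * (real n)\<^sup>2 \<le> 1/4 * (real n)\<^sup>2"
      using iso_pair[OF cd(1,2)] by (simp add: power2_eq_square)
    then show False using n_large by (simp add: power2_eq_square)
  qed
  then obtain j k where jk: "(w j k \<bullet> c)\<^sup>2 + (w j k \<bullet> d)\<^sup>2 \<ge> 1/4" by blast
  define y where "y = w j k"
  define s where "s = sqrt ((y \<bullet> c)\<^sup>2 + (y \<bullet> d)\<^sup>2)"
  have s2: "s\<^sup>2 = (y \<bullet> c)\<^sup>2 + (y \<bullet> d)\<^sup>2"
    unfolding s_def by simp
  have s: "s \<ge> 1/2"
    unfolding s_def by (rule real_le_rsqrt) (use jk in \<open>simp add: y_def power2_eq_square\<close>)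
  \<comment> \<open>\<open>e\<close> and \<open>\<nu>\<close> arise by rotating \<open>c\<close> and
    \<open>d\<close> in their plane until \<open>e\<close> points along the projection of
    \<open>y\<close> and \<open>\<nu>\<close> is orthogonal to \<open>y\<close>. The star of
    \<open>i\<close> stays almost orthogonal to both.\<close>
  define e where "e = ((y \<bullet> c) *\<^sub>R c + (y \<bullet> d) *\<^sub>R d) /\<^sub>R s"
  define \<nu> where "\<nu> = ((y \<bullet> c) *\<^sub>R d - (y \<bullet> d) *\<^sub>R c) /\<^sub>R s"
  have "((y \<bullet> c) *\<^sub>R c + (y \<bullet> d) *\<^sub>R d) \<bullet> ((y \<bullet> c) *\<^sub>R c + (y \<bullet> d) *\<^sub>R d) = s\<^sup>2"
       "((y \<bullet> c) *\<^sub>R d - (y \<bullet> d) *\<^sub>R c) \<bullet> ((y \<bullet> c) *\<^sub>R d - (y \<bullet> d) *\<^sub>R c) = s\<^sup>2"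
    unfolding s2
    by (simp_all add: inner_add_left inner_add_right inner_diff_left inner_diff_right cc cd power2_eq_square)
  moreover have "inverse s * (inverse s * s\<^sup>2) = 1"
    using s by (simp add: power2_eq_square field_simps)
  ultimately have "e \<bullet> e = 1" "\<nu> \<bullet> \<nu> = 1"
    unfolding e_def \<nu>_def inner_scaleR_left inner_scaleR_right by simp_all
  then have ne: "norm e = 1" "norm \<nu> = 1"
    by (simp_all add: norm_eq_1)
  have ortho: "e \<bullet> a = 0" "e \<bullet> b = 0" "\<nu> \<bullet> a = 0" "\<nu> \<bullet> b = 0"
    unfolding e_def \<nu>_def by (simp_all add: inner_add_left inner_diff_left cd)
  have y\<nu>: "y \<bullet> \<nu> = 0"
    unfolding \<nu>_def by (simp add: inner_diff_right)
  have ye: "y \<bullet> e \<ge> 1/2"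
  proof -
    have "y \<bullet> e = inverse s * s\<^sup>2"
      unfolding e_def s2 inner_scaleR_right by (simp add: inner_add_right power2_eq_square)
    also have "\<dots> = s"
      using s by (simp add: power2_eq_square)
    finally have "y \<bullet> e = s" .
    then show ?thesis using s by simp
  qed
  have star_i: "\<bar>w i l \<bullet> e\<bar> \<le> 1/10^9" "\<bar>w i l \<bullet> \<nu>\<bar> \<le> 1/10^9" for l
    using ab[OF ne(1) ortho(1,2)] ab[OF ne(2) ortho(3,4)] by simp_all
  have "y \<noteq> 0" using ye by auto
  then have jkG: "j \<in> G" "k \<in> G" "norm y = 1"
    using nonzero_unit[of j k] by (simp_all add: y_def)
  have "i \<noteq> j"
    using star_i(1)[of k] ye unfolding y_def by auto
  define q where "q = w i j"
  have nq: "norm q = 1" using unit[OF i jkG(1) \<open>i \<noteq> j\<close>] by (simp add: q_def)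
  then have qq: "q \<bullet> q = 1" by (simp add: dot_square_norm)
  have q_j: "q = w j i" by (simp add: q_def sym)
  have q_small: "\<bar>q \<bullet> e\<bar> \<le> 1/10^9" "\<bar>q \<bullet> \<nu>\<bar> \<le> 1/10^9"
    unfolding q_def by (rule star_i)+
  \<comment> \<open>The star of \<open>j\<close> contains \<open>q\<close>, almost orthogonal to
    \<open>e\<close> and \<open>\<nu>\<close>, and \<open>y\<close>, orthogonal to
    \<open>\<nu>\<close> with \<open>e\<close>-component at least \<open>1/2\<close>. Thinness in
    the columns \<open>q, e, \<nu>\<close> then keeps the whole star near the hyperplane.\<close>
  have star_j: "\<bar>w j m \<bullet> \<nu>\<bar> \<le> 10/10^9" for m
  proof -
    have "\<bar>(y \<bullet> e) * (w j m \<bullet> \<nu>)\<bar> \<le> 1 / 10^18 + 2 * \<bar>q \<bullet> e\<bar> + 2 * \<bar>q \<bullet> \<nu>\<bar>"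
      using thin_row[OF jkG(1) nq ne, of i k m] qq y\<nu> unfolding q_j[symmetric] y_def[symmetric] by simp
    also have "\<dots> \<le> 5 / 10^9"
      using q_small by simp
    finally have "(y \<bullet> e) * \<bar>w j m \<bullet> \<nu>\<bar> \<le> 5 / 10^9"
      using ye by (simp add: abs_mult)
    moreover have "1/2 * \<bar>w j m \<bullet> \<nu>\<bar> \<le> (y \<bullet> e) * \<bar>w j m \<bullet> \<nu>\<bar>"
      using ye by (intro mult_right_mono) auto
    ultimately show ?thesis by simp
  qed
  \<comment> \<open>The bound \<open>1/10\<close> is far above all accumulated errors, so
    \<open>i\<close> and \<open>j\<close> themselves are excluded.\<close>
  define R where "R = {m. \<exists>l. \<bar>w m l \<bullet> \<nu>\<bar> \<ge> 1/10}"
  have RG: "R \<subseteq> G"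
  proof
    fix m assume "m \<in> R"
    then obtain l where "\<bar>w m l \<bullet> \<nu>\<bar> \<ge> 1/10" unfolding R_def by blast
    then have "w m l \<noteq> 0" by auto
    then show "m \<in> G" using nonzero_unit by blast
  qed
  \<comment> \<open>Modulo \<open>q\<close> the star of \<open>m\<close> is almost one-dimensional,
    which says that the line of \<open>m\<close> passes near \<open>q\<close>.\<close>
  have R_minor: "\<bar>(w m l \<bullet> \<alpha>) * (w m l' \<bullet> \<beta>) - (w m l \<bullet> \<beta>) * (w m l' \<bullet> \<alpha>)\<bar> \<le> 4000/10^9"
    if m: "m \<in> R" and \<alpha>: "norm \<alpha> = 1" "\<alpha> \<bullet> q = 0" and \<beta>: "norm \<beta> = 1" "\<beta> \<bullet> q = 0" for m l l' \<alpha> \<beta>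
  proof -
    obtain p where p: "\<bar>w m p \<bullet> \<nu>\<bar> \<ge> 1/10" using m unfolding R_def by blast
    have mG: "m \<in> G" using m RG by blast
    have "m \<noteq> i" "m \<noteq> j"
      using p star_i(2)[of p] star_j[of p] by auto
    define x where "x = w m i"
    define x' where "x' = w m j"
    have nx: "norm x = 1" "norm x' = 1"
      using unit mG i jkG(1) \<open>m \<noteq> i\<close> \<open>m \<noteq> j\<close> by (simp_all add: x_def x'_def)
    have xi: "\<bar>x \<bullet> e\<bar> \<le> 1/10^9" "\<bar>x \<bullet> \<nu>\<bar> \<le> 1/10^9"
      unfolding x_def sym[of m i] by (rule star_i)+
    have x'j: "\<bar>x' \<bullet> \<nu>\<bar> \<le> 10/10^9"
      unfolding x'_def sym[of m j] by (rule star_j)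
    \<comment> \<open>Both \<open>x\<close> and \<open>x'\<close> almost lie in the hyperplane and
      \<open>w m p\<close> does not, so thinness makes \<open>x\<close> and \<open>x'\<close> nearly
      proportional. Hence \<open>x'\<close> inherits the small \<open>e\<close>-component of
      \<open>x\<close>.\<close>
    have x'e: "\<bar>x' \<bullet> e\<bar> \<le> 231/10^9"
    proof -
      have "\<bar>w m p \<bullet> \<nu>\<bar> * \<bar>(x \<bullet> x) * (x' \<bullet> e) - (x \<bullet> e) * (x' \<bullet> x)\<bar> \<le> 1/10^18 + 2 * \<bar>x \<bullet> \<nu>\<bar> + 2 * \<bar>x' \<bullet> \<nu>\<bar>"
        using thin_column[OF mG ne(2) nx(1) ne(1), of p i j] unfolding x_def[symmetric] x'_def[symmetric] .
      moreover have "1/10 * \<bar>(x \<bullet> x) * (x' \<bullet> e) - (x \<bullet> e) * (x' \<bullet> x)\<bar> \<le> \<bar>w m p \<bullet> \<nu>\<bar> * \<bar>(x \<bullet> x) * (x' \<bullet> e) - (x \<bullet> e) * (x' \<bullet> x)\<bar>"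
        using p by (intro mult_right_mono) auto
      moreover have "x \<bullet> x = 1" using nx by (simp add: dot_square_norm)
      ultimately have *: "\<bar>(x' \<bullet> e) - (x \<bullet> e) * (x' \<bullet> x)\<bar> \<le> 230/10^9"
        using xi x'j by simp
      have "\<bar>(x \<bullet> e) * (x' \<bullet> x)\<bar> \<le> \<bar>x \<bullet> e\<bar> * 1"
        unfolding abs_mult by (intro mult_left_mono abs_inner_le_1) (simp_all add: nx)
      then show ?thesis using * xi(1) by linarith
    qed
    \<comment> \<open>On the line of \<open>j\<close>, \<open>q\<close> has almost no
      \<open>e\<close>-component and \<open>y\<close> has at least \<open>1/2\<close>; since
      \<open>x'\<close> has almost none, it is close to a multiple of \<open>q\<close>.\<close>
    have x'f: "\<bar>x' \<bullet> f\<bar> \<le> 468/10^9" if f: "norm f = 1" "f \<bullet> q = 0" for f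
    proof -
      have "\<bar>(y \<bullet> e) * (x' \<bullet> f) - (y \<bullet> f) * (x' \<bullet> e)\<bar> \<le> 1/10^18 + 2 * \<bar>q \<bullet> e\<bar> + 2 * \<bar>q \<bullet> f\<bar>"
        using thin_row[OF jkG(1) nq ne(1) f(1), of i k m] qq
        unfolding q_j[symmetric] y_def[symmetric] x'_def sym[of m j] by simp
      moreover have "q \<bullet> f = 0" using f by (simp add: inner_commute)
      ultimately have *: "\<bar>(y \<bullet> e) * (x' \<bullet> f) - (y \<bullet> f) * (x' \<bullet> e)\<bar> \<le> 3/10^9"
        using q_small by simp
      have "\<bar>(y \<bullet> f) * (x' \<bullet> e)\<bar> \<le> 1 * \<bar>x' \<bullet> e\<bar>"
        unfolding abs_mult by (intro mult_right_mono abs_inner_le_1) (simp_all add: jkG f)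
      then have "\<bar>(y \<bullet> e) * (x' \<bullet> f)\<bar> \<le> 234/10^9"
        using * x'e by linarith
      moreover have "1/2 * \<bar>x' \<bullet> f\<bar> \<le> \<bar>(y \<bullet> e) * (x' \<bullet> f)\<bar>"
        unfolding abs_mult using ye by (intro mult_right_mono) auto
      ultimately show ?thesis by simp
    qed
    have x'q: "\<bar>x' \<bullet> q\<bar> \<ge> 1/2"
    proof -
      define g where "g = x' - (x' \<bullet> q) *\<^sub>R q"
      have gq: "g \<bullet> q = 0" by (simp add: g_def inner_diff_left qq)
      have "norm g \<le> 1/2"
      proof (cases "g = 0")
        case False
        define f where "f = g /\<^sub>R norm g"
        have "norm f = 1" "f \<bullet> q = 0" using False gq by (simp_all add: f_def)
        then have "\<bar>x' \<bullet> f\<bar> \<le> 468/10^9" by (rule x'f)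
        moreover have "x' \<bullet> f = norm g"
        proof -
          have "x' \<bullet> f = (g + (x' \<bullet> q) *\<^sub>R q) \<bullet> f" by (simp add: g_def)
          also have "\<dots> = g \<bullet> f"
            using gq by (simp add: f_def inner_add_left inner_commute[of q g])
          also have "\<dots> = norm g"
            using False by (simp add: f_def dot_square_norm power2_eq_square)
          finally show ?thesis .
        qed
        ultimately show ?thesis by simp
      qed simp
      moreover have "norm x' \<le> norm g + norm ((x' \<bullet> q) *\<^sub>R q)"
        unfolding g_def by (metis diff_add_cancel norm_triangle_ineq)
      ultimately show ?thesis using nx nq by simp
    qed
    let ?E = "\<bar>(w m l \<bullet> \<alpha>) * (w m l' \<bullet> \<beta>) - (w m l \<bullet> \<beta>) * (w m l' \<bullet> \<alpha>)\<bar>"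
    have "\<bar>x' \<bullet> q\<bar> * ?E \<le> 1/10^18 + 2 * \<bar>x' \<bullet> \<alpha>\<bar> + 2 * \<bar>x' \<bullet> \<beta>\<bar>"
      using thin_row[OF mG nq \<alpha>(1) \<beta>(1), of j l l'] unfolding x'_def[symmetric] .
    moreover have "1/2 * ?E \<le> \<bar>x' \<bullet> q\<bar> * ?E"
      using x'q by (intro mult_right_mono) auto
    ultimately show ?thesis
      using x'f[OF \<alpha>] x'f[OF \<beta>] by simp
  qed
  \<comment> \<open>The threshold is the square of \<open>1/20\<close>: \<open>w m l\<close> has
    distance at least \<open>1/20\<close> from the span of \<open>q\<close>.\<close>
  define D where "D m = {l \<in> R. (norm (w m l))\<^sup>2 - (w m l \<bullet> q)\<^sup>2 \<ge> 1/400}" for m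
  \<comment> \<open>The lines of \<open>m\<close> and \<open>l\<close> both pass near
    \<open>q\<close> and share \<open>w m l\<close> away from \<open>q\<close>. So all lines of
    \<open>D m\<close> are close to the span of \<open>q\<close> and \<open>r\<close>, and
    \<open>not_near_line\<close> bounds their number.\<close>
  have D_le: "real (card (D m)) \<le> 3/10 * n" if m: "m \<in> R" for m
  proof (cases "D m = {}")
    case False
    then obtain l0 where l0: "l0 \<in> D m" by blast
    define g where "g = w m l0 - (w m l0 \<bullet> q) *\<^sub>R q"
    have gq: "g \<bullet> q = 0" by (simp add: g_def inner_diff_left qq)
    have "(norm g)\<^sup>2 = (norm (w m l0))\<^sup>2 - (w m l0 \<bullet> q)\<^sup>2"
      unfolding power2_norm_eq_inner g_def
      by (simp add: inner_diff_left inner_diff_right qq inner_commute power2_eq_square)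
    then have "(norm g)\<^sup>2 \<ge> (1/20)\<^sup>2" using l0 by (simp add: D_def power2_eq_square)
    then have g: "norm g \<ge> 1/20" by (rule power2_le_imp_le) simp
    then have g0: "g \<noteq> 0" by auto
    define r where "r = g /\<^sub>R norm g"
    have r: "norm r = 1" "r \<bullet> q = 0" using g0 gq by (simp_all add: r_def)
    have wl0: "w m l0 \<bullet> f = g \<bullet> f" if "f \<bullet> q = 0" for f
      using that by (simp add: g_def inner_diff_left inner_commute[of q f])
    have l0r: "w m l0 \<bullet> r = norm g"
      unfolding wl0[OF r(2)] using g0 by (simp add: r_def dot_square_norm power2_eq_square)
    obtain \<beta>\<^sub>1 \<beta>\<^sub>2 where \<beta>: "norm \<beta>\<^sub>1 = 1" "norm \<beta>\<^sub>2 = 1" "\<beta>\<^sub>1 \<bullet> \<beta>\<^sub>2 = 0" "\<beta>\<^sub>1 \<bullet> q = 0" "\<beta>\<^sub>1 \<bullet> r = 0" "\<beta>\<^sub>2 \<bullet> q = 0" "\<beta>\<^sub>2 \<bullet> r = 0"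
      using orthonormal_pair_orthogonal_to[of q r] by blast
    have small: "\<bar>w m l \<bullet> \<beta>\<bar> \<le> 80000/10^9" if "norm \<beta> = 1" "\<beta> \<bullet> q = 0" "\<beta> \<bullet> r = 0" for \<beta> l
    proof -
      have "g \<bullet> \<beta> = 0" using that(3) g0 by (simp add: r_def inner_commute)
      then have "\<bar>norm g * (w m l \<bullet> \<beta>)\<bar> \<le> 4000/10^9"
        using R_minor[OF m r that(1,2), of l0 l] l0r wl0[OF that(2)] by simp
      moreover have "1/20 * \<bar>w m l \<bullet> \<beta>\<bar> \<le> norm g * \<bar>w m l \<bullet> \<beta>\<bar>"
        using g by (intro mult_right_mono) auto
      ultimately show ?thesis by (simp add: abs_mult)
    qed
    have large: "\<bar>w m l \<bullet> r\<bar> \<ge> 1/40" if l: "l \<in> D m" for l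
    proof -
      have "(norm (w m l))\<^sup>2 = (w m l \<bullet> q)\<^sup>2 + (w m l \<bullet> r)\<^sup>2 + (w m l \<bullet> \<beta>\<^sub>1)\<^sup>2 + (w m l \<bullet> \<beta>\<^sub>2)\<^sup>2"
        by (intro parseval_4 nq r(1) \<beta>) (use r \<beta> in \<open>simp_all add: inner_commute\<close>)
      moreover have "(w m l \<bullet> \<beta>\<^sub>1)\<^sup>2 \<le> (80000/10^9)\<^sup>2" "(w m l \<bullet> \<beta>\<^sub>2)\<^sup>2 \<le> (80000/10^9)\<^sup>2"
        using small[OF \<beta>(1,4,5), of l] small[OF \<beta>(2,6,7), of l] by (metis abs_ge_zero power2_abs power_mono)+
      ultimately have "(w m l \<bullet> r)\<^sup>2 \<ge> (1/40)\<^sup>2"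
        using l by (simp add: D_def power2_eq_square)
      then show ?thesis by (metis abs_ge_zero power2_abs power2_le_imp_le)
    qed
    \<comment> \<open>By symmetry \<open>w m l\<close> also belongs to the star of \<open>l\<close>.
      Its \<open>r\<close>-component is at least \<open>1/40\<close>, so the small minors in the
      star of \<open>l\<close> leave no room for a component along \<open>\<beta>\<close>.\<close>
    have final: "\<bar>w l p \<bullet> \<beta>\<bar> \<le> 1/100" if l: "l \<in> D m" and b: "norm \<beta> = 1" "\<beta> \<bullet> q = 0" "\<beta> \<bullet> r = 0" for l p \<beta>
    proof -
      have "\<bar>(w m l \<bullet> r) * (w l p \<bullet> \<beta>) - (w m l \<bullet> \<beta>) * (w l p \<bullet> r)\<bar> \<le> 4000/10^9"
        using R_minor[of l r \<beta> m p] l r b unfolding D_def sym[of l m] by simp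
      moreover have "\<bar>(w m l \<bullet> \<beta>) * (w l p \<bullet> r)\<bar> \<le> \<bar>w m l \<bullet> \<beta>\<bar> * 1"
        unfolding abs_mult by (intro mult_left_mono abs_inner_le_1) (simp_all add: norm_le_1 r)
      ultimately have "\<bar>w m l \<bullet> r\<bar> * \<bar>w l p \<bullet> \<beta>\<bar> \<le> 84000/10^9"
        using small[OF b, of l] unfolding abs_mult[symmetric] by linarith
      moreover have "1/40 * \<bar>w l p \<bullet> \<beta>\<bar> \<le> \<bar>w m l \<bullet> r\<bar> * \<bar>w l p \<bullet> \<beta>\<bar>"
        using large[OF l] by (intro mult_right_mono) auto
      ultimately show ?thesis by simp
    qed
    show ?thesis
    proof (rule not_near_line[of \<beta>\<^sub>1 \<beta>\<^sub>2])
      show "D m \<subseteq> {..<n}" using RG G_subset unfolding D_def by blast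
    qed (use \<beta> final in auto)
  qed simp
  have finR: "finite R" "R \<subseteq> {..<n}"
    using RG G_subset finite_subset[of R "{..<n}"] by auto
  have R_n: "real (card R) \<le> real n"
    using card_mono[of "{..<n}" R] finR by simp
  have finD: "finite (D m)" for m using finR(1) by (simp add: D_def)
  have R_large: "real (card R) \<ge> 79/100 * n"
  proof -
    \<comment> \<open>An entry with \<open>\<nu>\<close>-component at least \<open>1/10\<close> has
      both indices in \<open>R\<close> by symmetry. As \<open>q\<close> is almost orthogonal to
      \<open>\<nu>\<close>, the entry is far from \<open>q\<close>, so \<open>l\<close> lies in
      \<open>D m\<close>.\<close>
    have bound: "(w m l \<bullet> \<nu>)\<^sup>2 \<le> 1/100 + (if m \<in> R \<and> l \<in> D m then 1 else 0)" for m l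
    proof (cases "\<bar>w m l \<bullet> \<nu>\<bar> \<ge> 1/10")
      case True
      then have "m \<in> R" unfolding R_def by blast
      moreover have "l \<in> R" using True unfolding R_def sym[of m l] by blast
      ultimately have ml: "m \<in> R" "l \<in> R" .
      define x where "x = w m l - (w m l \<bullet> q) *\<^sub>R q"
      have x2: "(norm x)\<^sup>2 = (norm (w m l))\<^sup>2 - (w m l \<bullet> q)\<^sup>2"
        unfolding power2_norm_eq_inner x_def
        by (simp add: inner_diff_left inner_diff_right qq inner_commute power2_eq_square)
      have "w m l \<bullet> \<nu> = x \<bullet> \<nu> + (w m l \<bullet> q) * (q \<bullet> \<nu>)"
        by (simp add: x_def inner_diff_left)
      moreover have "\<bar>(w m l \<bullet> q) * (q \<bullet> \<nu>)\<bar> \<le> 1 * \<bar>q \<bullet> \<nu>\<bar>"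
        unfolding abs_mult by (intro mult_right_mono abs_inner_le_1) (simp_all add: norm_le_1 nq)
      moreover have "\<bar>x \<bullet> \<nu>\<bar> \<le> norm x"
        using Cauchy_Schwarz_ineq2[of x \<nu>] ne by simp
      moreover have "\<bar>q \<bullet> \<nu>\<bar> \<le> 1/20"
        by (rule order.trans[OF q_small(2)]) simp
      ultimately have "norm x \<ge> 1/20" using True by linarith
      then have "(norm x)\<^sup>2 \<ge> (1/20)\<^sup>2" by (intro power_mono) auto
      then have "l \<in> D m" using ml x2 by (simp add: D_def power2_eq_square)
      then show ?thesis
        using ml sq_inner_le_1[OF ne(2), of m l] by simp
    next
      case False
      then have "(w m l \<bullet> \<nu>)\<^sup>2 \<le> (1/10)\<^sup>2"
        by (metis abs_ge_zero less_eq_real_def linorder_not_less power2_abs power_mono)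
      then show ?thesis by (simp add: power2_eq_square)
    qed
    have "(\<Sum>m<n. \<Sum>l<n. (w m l \<bullet> \<nu>)\<^sup>2) \<le> (\<Sum>m<n. \<Sum>l<n. 1/100 + (if m \<in> R \<and> l \<in> D m then 1 else 0))"
      by (intro sum_mono bound)
    also have "\<dots> = 1/100 * (real n)\<^sup>2 + (\<Sum>m<n. \<Sum>l<n. if m \<in> R \<and> l \<in> D m then 1 else 0)"
      by (simp add: sum.distrib power2_eq_square)
    also have "(\<Sum>m<n. \<Sum>l<n. if m \<in> R \<and> l \<in> D m then 1 else 0::real) = (\<Sum>m\<in>R. real (card (D m)))"
    proof -
      have "D m \<subseteq> {..<n}" for m using finR by (auto simp: D_def)
      then have "(\<Sum>l<n. if m \<in> R \<and> l \<in> D m then 1 else 0::real) = (if m \<in> R then real (card (D m)) else 0)" for m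
        by (auto simp: sum.If_cases Int_absorb1)
      then show ?thesis
        using finR by (simp add: sum.If_cases Int_absorb1)
    qed
    also have "\<dots> \<le> (\<Sum>m\<in>R. 3/10 * real n)"
      by (intro sum_mono D_le)
    also have "\<dots> = real (card R) * (3/10 * real n)" by simp
    finally have "249/1000 * (real n)\<^sup>2 \<le> 1/100 * (real n)\<^sup>2 + real (card R) * (3/10 * real n)"
      using iso[OF ne(2)] by linarith
    \<comment> \<open>Here \<open>239/1000\<close> is \<open>249/1000 - 1/100\<close>, and its
      quotient by \<open>3/10\<close> exceeds \<open>79/100\<close>.\<close>
    then have "real n * (239/1000 * real n) \<le> real n * (3/10 * real (card R))"
      by (simp add: power2_eq_square algebra_simps)
    then show ?thesis using n_large by simp
  qed
  \<comment> \<open>Entries within \<open>R\<close> and outside \<open>D m\<close> are close to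
    multiples of \<open>q\<close>. The index \<open>m\<close> is removed because diagonal vectors
    are zero.\<close>
  have "(\<Sum>m<n. \<Sum>l<n. (w m l \<bullet> q)\<^sup>2) \<ge> (\<Sum>m\<in>R. \<Sum>l\<in>R - D m - {m}. 9/10)"
  proof -
    have "(\<Sum>m\<in>R. \<Sum>l\<in>R - D m - {m}. 9/10) \<le> (\<Sum>m\<in>R. \<Sum>l\<in>R - D m - {m}. (w m l \<bullet> q)\<^sup>2)"
    proof (intro sum_mono)
      fix m l assume m: "m \<in> R" and l: "l \<in> R - D m - {m}"
      then have "norm (w m l) = 1" using RG unit by blast
      then show "9/10 \<le> (w m l \<bullet> q)\<^sup>2" using l by (auto simp: D_def)
    qed
    also have "\<dots> \<le> (\<Sum>m<n. \<Sum>l<n. (w m l \<bullet> q)\<^sup>2)"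
      using finR by (intro order.trans[OF sum_mono[OF sum_mono2] sum_mono2]) (auto intro: sum_nonneg)
    finally show ?thesis .
  qed
  moreover have "(\<Sum>m\<in>R. \<Sum>l\<in>R - D m - {m}. 9/10) \<ge> (\<Sum>m\<in>R. (79/100 * n - 3/10 * n - 1) * (9/10))"
  proof (intro sum_mono)
    fix m assume m: "m \<in> R"
    have "card (R - D m - {m}) \<ge> card R - card (D m) - 1"
      using diff_card_le_card_Diff[of "D m" R] diff_card_le_card_Diff[of "{m}" "R - D m"] finD by simp
    then have "real (card (R - D m - {m})) \<ge> 79/100 * n - 3/10 * n - 1"
      using D_le[OF m] R_large by linarith
    then show "(79/100 * n - 3/10 * n - 1) * (9/10) \<le> (\<Sum>l\<in>R - D m - {m}. 9/10::real)" by simp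
  qed
  moreover have "(\<Sum>m\<in>R. (79/100 * n - 3/10 * n - 1) * (9/10)) \<ge> (79/100 * n) * ((79/100 * n - 3/10 * n - 1) * (9/10::real))"
    using R_large n_large by (simp only: sum_constant) (intro mult_right_mono, simp_all)
  \<comment> \<open>The leading coefficient on the left is about \<open>0.348\<close>, too large for
    the upper bound \<open>253/1000\<close>.\<close>
  ultimately have "(79/100 * n) * ((79/100 * n - 3/10 * n - 1) * (9/10::real)) \<le> 253/1000 * (real n)\<^sup>2"
    using iso_upper[OF nq] by linarith
  then have "real n * (79/100 * ((49/100 * n - 1) * (9/10))) \<le> real n * (253/1000 * real n)"
    by (simp add: power2_eq_square algebra_simps)
  then have "79/100 * ((49/100 * n - 1) * (9/10)) \<le> 253/1000 * real n"
    using n_large by simp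
  then show False using n_large by simp
qed

end

subsection \<open>Radial isotropic position\<close>

text \<open>A weak form of Hadamard's inequality: each Leibniz term is bounded by the product of the
  row norms.\<close>

lemma abs_det_le:
  fixes Y :: "real^'n^'n"
  shows "\<bar>det Y\<bar> \<le> fact CARD('n) * (\<Prod>k\<in>UNIV. norm (Y $ k))"
proof -
  have "\<bar>det Y\<bar> \<le> (\<Sum>p | p permutes (UNIV::'n set). \<bar>of_int (sign p) * (\<Prod>i\<in>UNIV. Y $ i $ p i)\<bar>)"
    unfolding det_def by (rule sum_abs)
  also have "\<dots> \<le> (\<Sum>p | p permutes (UNIV::'n set). \<Prod>k\<in>UNIV. norm (Y $ k))"
  proof (intro sum_mono)
    fix p
    have "\<bar>of_int (sign p) * (\<Prod>i\<in>UNIV. Y $ i $ p i)\<bar> = (\<Prod>i\<in>UNIV. \<bar>Y $ i $ p i\<bar>)"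
      by (simp add: abs_mult sign_def abs_prod)
    also have "\<dots> \<le> (\<Prod>k\<in>UNIV. norm (Y $ k))"
      by (intro prod_mono) (simp add: component_le_norm_cart)
    finally show "\<bar>of_int (sign p) * (\<Prod>i\<in>UNIV. Y $ i $ p i)\<bar> \<le> (\<Prod>k\<in>UNIV. norm (Y $ k))" .
  qed
  also have "\<dots> = fact CARD('n) * (\<Prod>k\<in>UNIV. norm (Y $ k))"
    by (simp add: card_permutations)
  finally show ?thesis .
qed

lemma continuous_on_det [continuous_intros]:
  fixes f :: "'a::topological_space \<Rightarrow> real^'n^'n"
  assumes "continuous_on S f"
  shows "continuous_on S (\<lambda>x. det (f x))"
  unfolding det_def by (intro continuous_intros assms)

lemma continuous_on_matrix_vector_mult [continuous_intros]:
  fixes f :: "'a::topological_space \<Rightarrow> real^'n^'m"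
  assumes "continuous_on S f"
  shows "continuous_on S (\<lambda>x. f x *v v)"
  unfolding matrix_vector_mult_def
  by (intro continuous_on_vec_lambda continuous_intros assms)

lemma det_rows_image:
  fixes A :: "real^'n^'n" and r :: "'n \<Rightarrow> real^'n"
  shows "det (\<chi> k. A *v r k) = det A * det (\<chi> k. r k)"
proof -
  have "(\<chi> k. A *v r k) = (\<chi> k. r k) ** transpose A"
    by (simp add: vec_eq_iff matrix_matrix_mult_def matrix_vector_mult_def transpose_def mult.commute)
  then show ?thesis by (simp add: det_mul det_transpose)
qed

text \<open>Linear general position: any four vectors with distinct indices form a basis.\<close>

definition generic_vectors :: "'i set \<Rightarrow> ('i \<Rightarrow> real^4) \<Rightarrow> bool" where
  "generic_vectors X v \<longleftrightarrow> (\<forall>f :: 4 \<Rightarrow> 'i. inj f \<and> range f \<subseteq> X \<longrightarrow> det (\<chi> k. v (f k)) \<noteq> 0)"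

lemma generic_image_not_all_zero:
  fixes A :: "real^4^4"
  assumes "det (\<chi> k. v (f k)) \<noteq> 0" "\<And>k. A *v v (f k) = 0"
  shows "A = 0"
proof -
  let ?M = "\<chi> k. v (f k)"
  have "?M ** transpose A = (\<chi> k. A *v v (f k))"
    by (simp add: vec_eq_iff matrix_matrix_mult_def matrix_vector_mult_def transpose_def mult.commute)
  also have "\<dots> = 0" using assms(2) by (simp add: vec_eq_iff)
  finally have "?M ** transpose A = 0" .
  moreover have "invertible ?M" using assms(1) by (simp add: invertible_det_nz)
  ultimately have "transpose A = 0"
    by (metis invertible_left_inverse matrix_mul_assoc matrix_mul_lid times0_right)
  then show ?thesis by (simp add: vec_eq_iff transpose_def)
qed

text \<open>For a fixed quadruple the sum of the image norms is continuous and positive on the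
  compact unit sphere of matrices, and there are only finitely many quadruples.\<close>

lemma generic_large_image:
  assumes "finite X" "generic_vectors X v"
  obtains \<kappa> where "\<kappa> > 0"
    "\<And>(A :: real^4^4) f. \<lbrakk>norm A = 1; inj (f :: 4 \<Rightarrow> 'i); range f \<subseteq> X\<rbrakk> \<Longrightarrow> \<exists>k. norm (A *v v (f k)) \<ge> \<kappa>"
proof -
  define F where "F = {f :: 4 \<Rightarrow> 'i. inj f \<and> range f \<subseteq> X}"
  have "F \<subseteq> UNIV \<rightarrow>\<^sub>E X" unfolding F_def by auto
  then have finF: "finite F"
    using finite_PiE[of "UNIV :: 4 set" "\<lambda>_. X"] assms(1) finite_subset by auto
  have "\<exists>\<kappa>>0. \<forall>A :: real^4^4. norm A = 1 \<longrightarrow> (\<exists>k. norm (A *v v (f k)) \<ge> \<kappa>)" if f: "f \<in> F" for f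
  proof -
    let ?S = "sphere (0::real^4^4) 1"
    let ?g = "\<lambda>A::real^4^4. \<Sum>k\<in>UNIV. norm (A *v v (f k))"
    have "continuous_on ?S ?g" by (intro continuous_intros)
    moreover have "?S \<noteq> {}" by simp
    ultimately obtain A0 where A0: "A0 \<in> ?S" "\<And>A. A \<in> ?S \<Longrightarrow> ?g A0 \<le> ?g A"
      using continuous_attains_inf[of ?S ?g] compact_sphere by blast
    have pos: "?g A0 > 0"
    proof (rule ccontr)
      assume "\<not> ?thesis"
      then have "?g A0 = 0" by (simp add: order_antisym not_less sum_nonneg)
      then have "\<And>k. A0 *v v (f k) = 0" by (simp add: sum_nonneg_eq_0_iff)
      then have "A0 = 0"
        using generic_image_not_all_zero[of v f A0] f assms(2) unfolding F_def generic_vectors_def by blast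
      then show False using A0(1) by simp
    qed
    show ?thesis
    proof (rule exI[of _ "?g A0 / 4"], intro conjI allI impI)
      show "?g A0 / 4 > 0" using pos by simp
      fix A :: "real^4^4" assume "norm A = 1"
      then have le: "?g A0 \<le> ?g A" using A0(2) by simp
      show "\<exists>k. norm (A *v v (f k)) \<ge> ?g A0 / 4"
      proof (rule ccontr)
        assume "\<not> ?thesis"
        then have "?g A < (\<Sum>k\<in>(UNIV :: 4 set). ?g A0 / 4)"
          by (intro sum_strict_mono) (auto simp: not_le)
        also have "\<dots> = ?g A0" by simp
        finally show False using le by simp
      qed
    qed
  qed
  then obtain \<kappa> where \<kappa>: "\<And>f. f \<in> F \<Longrightarrow> \<kappa> f > 0"
    "\<And>f (A :: real^4^4). f \<in> F \<Longrightarrow> norm A = 1 \<Longrightarrow> \<exists>k. norm (A *v v (f k)) \<ge> \<kappa> f"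
    by metis
  define \<kappa>' where "\<kappa>' = Min (insert 1 (\<kappa> ` F))"
  have le: "\<kappa>' \<le> \<kappa> f" if "f \<in> F" for f
    unfolding \<kappa>'_def using finF that by (intro Min_le) auto
  show ?thesis
  proof (rule that[of \<kappa>'])
    show "\<kappa>' > 0" unfolding \<kappa>'_def using finF \<kappa>(1) by (subst Min_gr_iff) auto
    fix A :: "real^4^4" and f :: "4 \<Rightarrow> 'i"
    assume "norm A = 1" "inj f" "range f \<subseteq> X"
    then have "f \<in> F" by (simp add: F_def)
    then show "\<exists>k. norm (A *v v (f k)) \<ge> \<kappa>'"
      using \<kappa>(2)[of f A] le[of f] \<open>norm A = 1\<close> order.trans by blast
  qed
qed

text \<open>No four vectors are all shrunk below \<open>\<kappa>\<close>, so the shrunk ones fit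
  into a four-element set. There the determinant bounds the product of the norms from below, and
  every other factor is at least \<open>\<kappa>\<close>.\<close>

lemma generic_prod_image_ge:
  assumes "finite X" "card X \<ge> 4" "generic_vectors X v"
  obtains C where "C > 0"
    "\<And>A :: real^4^4. norm A = 1 \<Longrightarrow> (\<Prod>x\<in>X. norm (A *v v x)) \<ge> C * \<bar>det A\<bar>"
proof -
  obtain \<kappa> where \<kappa>: "\<kappa> > 0"
    "\<And>(A :: real^4^4) f. \<lbrakk>norm A = 1; inj (f :: 4 \<Rightarrow> 'a); range f \<subseteq> X\<rbrakk> \<Longrightarrow> \<exists>k. norm (A *v v (f k)) \<ge> \<kappa>"
    using generic_large_image[OF assms(1,3)] by blast
  define F where "F = {f :: 4 \<Rightarrow> 'a. inj f \<and> range f \<subseteq> X}"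
  have "F \<subseteq> UNIV \<rightarrow>\<^sub>E X" unfolding F_def by auto
  then have finF: "finite F"
    using finite_PiE[of "UNIV :: 4 set" "\<lambda>_. X"] assms(1) finite_subset by auto
  define \<delta> where "\<delta> = Min (insert 1 ((\<lambda>f. \<bar>det (\<chi> k. v (f k))\<bar>) ` F))"
  have \<delta>0: "\<delta> > 0"
    unfolding \<delta>_def using finF assms(3) by (subst Min_gr_iff) (auto simp: F_def generic_vectors_def)
  have \<delta>: "\<delta> \<le> \<bar>det (\<chi> k. v (f k))\<bar>" if "f \<in> F" for f
    unfolding \<delta>_def using finF that by (intro Min_le) auto
  show ?thesis
  proof (rule that[of "\<delta> / 24 * \<kappa> ^ (card X - 4)"])
    show "\<delta> / 24 * \<kappa> ^ (card X - 4) > 0" using \<delta>0 \<kappa>(1) by simp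
    fix A :: "real^4^4" assume A: "norm A = 1"
    define S where "S = {x \<in> X. norm (A *v v x) < \<kappa>}"
    have "card S \<le> 4"
    proof (rule ccontr)
      assume "\<not> ?thesis"
      then obtain Y where "Y \<subseteq> S" "card Y = 4"
        by (metis nat_le_linear obtain_subset_with_card_n)
      moreover have "finite Y" using \<open>card Y = 4\<close> by (metis card.infinite zero_neq_numeral)
      ultimately obtain f :: "4 \<Rightarrow> 'a" where f: "bij_betw f UNIV Y"
        using finite_same_card_bij[of "UNIV :: 4 set" Y] by auto
      then have "inj f" "range f \<subseteq> S" using \<open>Y \<subseteq> S\<close> by (auto simp: bij_betw_def)
      moreover have "range f \<subseteq> X" using \<open>range f \<subseteq> S\<close> unfolding S_def by blast
      ultimately obtain k where "norm (A *v v (f k)) \<ge> \<kappa>" using \<kappa>(2)[OF A] by blast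
      moreover have "f k \<in> S" using \<open>range f \<subseteq> S\<close> by blast
      ultimately show False by (simp add: S_def)
    qed
    then obtain Y where Y: "S \<subseteq> Y" "Y \<subseteq> X" "card Y = 4"
      using exists_subset_between[of S 4 X] assms unfolding S_def by auto
    have finY: "finite Y" using Y(2) assms(1) finite_subset by blast
    then obtain f :: "4 \<Rightarrow> 'a" where f: "bij_betw f UNIV Y"
      using finite_same_card_bij[of "UNIV :: 4 set" Y] Y(3) by auto
    then have fF: "f \<in> F" using Y(2) by (auto simp: F_def bij_betw_def)
    have "\<bar>det A\<bar> * \<delta> \<le> \<bar>det A\<bar> * \<bar>det (\<chi> k. v (f k))\<bar>"
      using \<delta>[OF fF] by (intro mult_left_mono) auto
    also have "\<dots> = \<bar>det (\<chi> k. A *v v (f k))\<bar>"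
      by (simp add: det_rows_image abs_mult)
    also have "\<dots> \<le> fact CARD(4) * (\<Prod>k\<in>UNIV. norm (A *v v (f k)))"
      using abs_det_le[of "\<chi> k. A *v v (f k)"] by simp
    also have "(\<Prod>k\<in>UNIV. norm (A *v v (f k))) = (\<Prod>x\<in>Y. norm (A *v v x))"
      using f by (rule prod.reindex_bij_betw)
    finally have 1: "\<bar>det A\<bar> * (\<delta> / 24) \<le> (\<Prod>x\<in>Y. norm (A *v v x))"
      by (simp add: fact_numeral)
    have "\<kappa> ^ (card X - 4) = (\<Prod>x\<in>X - Y. \<kappa>)"
      using Y finY by (simp add: card_Diff_subset)
    also have "\<dots> \<le> (\<Prod>x\<in>X - Y. norm (A *v v x))"
      using \<kappa>(1) Y(1) by (intro prod_mono) (auto simp: S_def)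
    finally have "(\<bar>det A\<bar> * (\<delta> / 24)) * \<kappa> ^ (card X - 4)
        \<le> (\<Prod>x\<in>Y. norm (A *v v x)) * (\<Prod>x\<in>X - Y. norm (A *v v x))"
      using 1 \<kappa>(1) by (intro mult_mono) (auto intro!: prod_nonneg)
    also have "\<dots> = (\<Prod>x\<in>X. norm (A *v v x))"
      using prod.subset_diff[OF Y(2) assms(1), of "\<lambda>x. norm (A *v v x)"] by (simp add: mult.commute)
    finally show "\<delta> / 24 * \<kappa> ^ (card X - 4) * \<bar>det A\<bar> \<le> (\<Prod>x\<in>X. norm (A *v v x))"
      by (simp add: ac_simps)
  qed
qed

lemma det_scaleR:
  fixes B :: "real^'n^'n"
  shows "det (c *\<^sub>R B) = c ^ CARD('n) * det B"
proof -
  have "c *\<^sub>R B = (\<chi> i. c *s B $ i)"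
    by (simp add: vec_eq_iff)
  then show ?thesis by (simp add: det_rows_mul)
qed

text \<open>A stretch by \<open>1 + s\<close> along \<open>u\<close>, up to a rotation;
  \<open>2 * s + s\<^sup>2\<close> is \<open>(1 + s)\<^sup>2 - 1\<close>. It supplies the variation
  at the maximizer.\<close>

lemma stretch_matrix:
  fixes u :: "real^4"
  assumes "norm u = 1" "s \<ge> 0"
  obtains B :: "real^4^4" where "det B = 1 + s"
    "\<And>y. (norm (B *v y))\<^sup>2 = (norm y)\<^sup>2 + (2 * s + s\<^sup>2) * (y \<bullet> u)\<^sup>2"
proof -
  obtain Q :: "real^4^4" where Q: "rotation_matrix Q" "Q *v axis 1 1 = u"
    using rotation_matrix_exists_basis[of u 1] assms(1) by auto
  define D :: "real^4^4" where "D = (\<chi> i j. if i = j then (if i = 1 then 1 + s else 1) else 0)"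
  have detD: "det D = 1 + s"
    by (subst det_diagonal) (auto simp: D_def prod.If_cases)
  have Dz: "(norm (D *v z))\<^sup>2 = (norm z)\<^sup>2 + (2 * s + s\<^sup>2) * (z $ 1)\<^sup>2" for z
    unfolding power2_norm_eq_inner
    by (simp add: D_def matrix_vector_mult_def inner_vec_def sum_4 power2_eq_square algebra_simps)
  have orth: "orthogonal_matrix Q" "det Q = 1" using Q(1) by (simp_all add: rotation_matrix_def)
  show ?thesis
  proof (rule that[of "D ** transpose Q"])
    show "det (D ** transpose Q) = 1 + s"
      by (simp add: det_mul detD orth det_transpose)
    fix y
    have "orthogonal_transformation ((*v) (transpose Q))"
      using orth(1) by (simp add: orthogonal_transformation_matrix orthogonal_matrix_transpose)
    then have 1: "norm (transpose Q *v y) = norm y"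
      using orthogonal_transformation_norm[of "(*v) (transpose Q)" y] by blast
    have "(transpose Q *v y) $ 1 = (transpose Q *v y) \<bullet> axis 1 1"
      by (simp add: inner_axis)
    also have "\<dots> = y \<bullet> u"
      by (simp add: dot_lmul_matrix Q(2))
    finally have 2: "(transpose Q *v y) $ 1 = y \<bullet> u" .
    show "(norm ((D ** transpose Q) *v y))\<^sup>2 = (norm y)\<^sup>2 + (2 * s + s\<^sup>2) * (y \<bullet> u)\<^sup>2"
      unfolding matrix_vector_mul_assoc[symmetric] Dz 1 2 ..
  qed
qed

text \<open>The functional is invariant under positive scaling, so unit matrices suffice. Near
  singular ones it is at most \<open>\<bar>det A\<bar> ^ (N - 4) / C ^ 4\<close>, which tends to
  zero because \<open>N > 4\<close>; so the supremum is attained on a compact set.\<close>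

lemma det_prod_maximizer:
  assumes "finite X" "card X > 4" "generic_vectors X v"
  obtains A :: "real^4^4" where "det A \<noteq> 0"
    "\<And>B. det B \<noteq> 0 \<Longrightarrow> \<bar>det B\<bar> ^ card X / (\<Prod>x\<in>X. norm (B *v v x)) ^ 4
        \<le> \<bar>det A\<bar> ^ card X / (\<Prod>x\<in>X. norm (A *v v x)) ^ 4"
proof -
  define N where "N = card X"
  define P where "P A = (\<Prod>x\<in>X. norm (A *v v x))" for A :: "real^4^4"
  define h where "h A = \<bar>det A\<bar> ^ N / P A ^ 4" for A :: "real^4^4"
  have N: "N > 4" using assms(2) by (simp add: N_def)
  obtain C where C: "C > 0" "\<And>A :: real^4^4. norm A = 1 \<Longrightarrow> P A \<ge> C * \<bar>det A\<bar>"
    using generic_prod_image_ge[of X v] assms unfolding P_def by (metis less_imp_le)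
  have bound: "h A \<le> \<bar>det A\<bar> ^ (N - 4) / C ^ 4" if "norm A = 1" "det A \<noteq> 0" for A
  proof -
    have "h A \<le> \<bar>det A\<bar> ^ N / (C * \<bar>det A\<bar>) ^ 4"
      unfolding h_def using C that by (intro divide_left_mono power_mono) (auto intro!: mult_pos_pos zero_less_power
        less_le_trans[OF _ C(2)])
    also have "\<dots> = \<bar>det A\<bar> ^ (N - 4) / C ^ 4"
      using N that C(1) by (simp add: power_mult_distrib power_diff field_simps)
    finally show ?thesis .
  qed
  have scale: "h (c *\<^sub>R A) = h A" if "c > 0" for c A
  proof -
    have "P (c *\<^sub>R A) = c ^ N * P A"
      using that by (simp add: P_def N_def prod.distrib flip: scaleR_matrix_vector_assoc)
    then show ?thesis
      using that by (simp add: h_def det_scaleR abs_mult power_mult_distrib mult.commute flip: power_mult)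
  qed
  define I :: "real^4^4" where "I = mat 1 /\<^sub>R norm (mat 1 :: real^4^4)"
  have m0: "norm (mat 1 :: real^4^4) > 0"
    by (simp add: mat_def vec_eq_iff)
  have I: "norm I = 1" "det I \<noteq> 0"
    using m0 by (simp_all add: I_def det_scaleR)
  have hI: "h I > 0"
    unfolding h_def using I C by (intro divide_pos_pos zero_less_power less_le_trans[OF _ C(2)]) auto
  \<comment> \<open>Chosen so that the normalised identity \<open>I\<close> lies in \<open>K\<close>
    and no invertible unit matrix outside \<open>K\<close> exceeds \<open>h I\<close>.\<close>
  define \<delta> where "\<delta> = min \<bar>det I\<bar> (min 1 (C ^ 4 * h I))"
  have \<delta>: "\<delta> > 0" "\<delta> \<le> \<bar>det I\<bar>" "\<delta> \<le> 1" "\<delta> \<le> C ^ 4 * h I"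
    using I hI C by (auto simp: \<delta>_def)
  define K where "K = {A. norm A = 1 \<and> \<delta> \<le> \<bar>det (A :: real^4^4)\<bar>}"
  have "compact K"
  proof -
    have "closed {A :: real^4^4. \<delta> \<le> \<bar>det A\<bar>}"
      by (intro closed_Collect_le continuous_intros)
    moreover have "K = sphere 0 1 \<inter> {A. \<delta> \<le> \<bar>det A\<bar>}" by (auto simp: K_def)
    ultimately show ?thesis by (simp add: compact_Int_closed)
  qed
  moreover have "K \<noteq> {}" using I \<delta> by (auto simp: K_def)
  moreover have "continuous_on K h"
  proof -
    have "P A \<noteq> 0" if "A \<in> K" for A
      using C(2)[of A] C(1) \<delta>(1) that by (auto simp: K_def mult_le_0_iff)
    then show ?thesis
      unfolding h_def P_def by (intro continuous_intros) auto
  qed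
  ultimately obtain A where A: "A \<in> K" "\<And>B. B \<in> K \<Longrightarrow> h B \<le> h A"
    using continuous_attains_sup[of K h] by blast
  have "h B \<le> h A" if B: "det B \<noteq> 0" for B
  proof -
    have "B \<noteq> 0" using B det_scaleR[of 0 B] by auto
    define B' where "B' = B /\<^sub>R norm B"
    have B': "norm B' = 1" "det B' \<noteq> 0" "h B' = h B"
      using \<open>B \<noteq> 0\<close> B scale[of "inverse (norm B)" B] by (simp_all add: B'_def det_scaleR)
    show ?thesis
    proof (cases "\<delta> \<le> \<bar>det B'\<bar>")
      case True
      then show ?thesis using A(2)[of B'] B' by (simp add: K_def)
    next
      case False
      have "h B' \<le> \<bar>det B'\<bar> ^ (N - 4) / C ^ 4" using bound B' by blast
      also have "\<dots> \<le> \<bar>det B'\<bar> ^ 1 / C ^ 4"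
        using False \<delta> N C(1) by (intro divide_right_mono power_decreasing) auto
      also have "\<dots> \<le> h I"
        using False \<delta>(4) C(1) by (simp add: field_simps)
      also have "\<dots> \<le> h A" using A(2)[of I] I \<delta> by (simp add: K_def)
      finally show ?thesis using B'(3) by simp
    qed
  qed
  then show ?thesis
    using that[of A] A(1) \<delta>(1) unfolding K_def h_def P_def N_def by auto
qed

text \<open>First-order optimality: compare the maximizer \<open>A\<close> with
  \<open>B ** A\<close>, where \<open>B\<close> stretches by \<open>1 + s\<close> along
  \<open>u\<close>. The logarithm of the comparison, divided by \<open>s\<close>, gives the bound as
  \<open>s\<close> tends to zero.\<close>

lemma radial_isotropic_position:
  assumes "finite X" "card X > 4" "generic_vectors X v"
  obtains A :: "real^4^4" where "det A \<noteq> 0" "\<And>x. x \<in> X \<Longrightarrow> A *v v x \<noteq> 0"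
    "\<And>u. norm u = 1 \<Longrightarrow> real (card X) / 4 \<le> (\<Sum>x\<in>X. (((A *v v x) /\<^sub>R norm (A *v v x)) \<bullet> u)\<^sup>2)"
proof -
  define N where "N = card X"
  obtain A :: "real^4^4" where A: "det A \<noteq> 0"
    "\<And>B. det B \<noteq> 0 \<Longrightarrow> \<bar>det B\<bar> ^ N / (\<Prod>x\<in>X. norm (B *v v x)) ^ 4
        \<le> \<bar>det A\<bar> ^ N / (\<Prod>x\<in>X. norm (A *v v x)) ^ 4"
    using det_prod_maximizer[OF assms] unfolding N_def by blast
  have nz: "A *v v x \<noteq> 0" if x: "x \<in> X" for x
  proof -
    have "card {x} \<le> 4" by simp
    then obtain Y where Y: "{x} \<subseteq> Y" "Y \<subseteq> X" "card Y = 4"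
      using exists_subset_between[of "{x}" 4 X] assms x by auto
    have "finite Y" using Y(2) assms(1) finite_subset by blast
    then obtain f :: "4 \<Rightarrow> 'a" where f: "bij_betw f UNIV Y"
      using finite_same_card_bij[of "UNIV :: 4 set" Y] Y(3) by auto
    obtain k where k: "f k = x" using f Y(1) by (metis bij_betw_imp_surj_on imageE insert_subset)
    have d: "det (\<chi> k. v (f k)) \<noteq> 0"
      using assms(3) f Y(2) unfolding generic_vectors_def bij_betw_def by blast
    have "v x \<noteq> 0"
    proof
      assume "v x = 0"
      then have "row k (\<chi> k. v (f k)) = 0" by (simp add: row_def k vec_eq_iff)
      then show False using d det_zero_row by blast
    qed
    then show ?thesis
      using A(1) by (metis invertible_det_nz invertible_eq_bij bij_is_inj inj_eq matrix_vector_mult_0_right)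
  qed
  define c where "c u x = (((A *v v x) /\<^sub>R norm (A *v v x)) \<bullet> u)\<^sup>2" for u x
  have main: "real N * ln (1 + s) \<le> 2 * ((2 * s + s\<^sup>2) * (\<Sum>x\<in>X. c u x))" if u: "norm u = 1" and s: "s > 0" for u s
  proof -
    obtain B :: "real^4^4" where B: "det B = 1 + s"
      "\<And>y. (norm (B *v y))\<^sup>2 = (norm y)\<^sup>2 + (2 * s + s\<^sup>2) * (y \<bullet> u)\<^sup>2"
      using stretch_matrix[OF u, of s] s by auto
    define k where "k = 2 * s + s\<^sup>2"
    have k: "k > 0" using s by (simp add: k_def add_pos_pos)
    let ?PA = "\<Prod>x\<in>X. norm (A *v v x)" and ?PB = "\<Prod>x\<in>X. norm ((B ** A) *v v x)"
    have PA: "?PA > 0" using nz by (intro prod_pos) auto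
    have sq: "(norm ((B ** A) *v v x))\<^sup>2 = (norm (A *v v x))\<^sup>2 * (1 + k * c u x)" if "x \<in> X" for x
      using nz[OF that] by (simp add: c_def k_def B(2) power_mult_distrib power_divide field_simps flip: matrix_vector_mul_assoc)
    have "?PB ^ 4 = (\<Prod>x\<in>X. (norm ((B ** A) *v v x))\<^sup>2)\<^sup>2"
      by (simp add: prod_power_distrib flip: power_mult)
    also have "\<dots> = (\<Prod>x\<in>X. (norm (A *v v x))\<^sup>2 * (1 + k * c u x))\<^sup>2"
      using sq by (simp cong: prod.cong)
    also have "\<dots> = ?PA ^ 4 * (\<Prod>x\<in>X. 1 + k * c u x)\<^sup>2"
      by (simp add: prod.distrib power_mult_distrib prod_power_distrib flip: power_mult)
    finally have PB: "?PB ^ 4 = ?PA ^ 4 * (\<Prod>x\<in>X. 1 + k * c u x)\<^sup>2" .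
    have c0: "c u x \<ge> 0" for x by (simp add: c_def)
    have pos: "(\<Prod>x\<in>X. 1 + k * c u x) > 0"
      using k c0 by (intro prod_pos) (simp add: add_pos_nonneg)
    have "\<bar>det (B ** A)\<bar> = (1 + s) * \<bar>det A\<bar>"
      using s by (simp add: det_mul B(1) abs_mult)
    then have "((1 + s) * \<bar>det A\<bar>) ^ N / (?PA ^ 4 * (\<Prod>x\<in>X. 1 + k * c u x)\<^sup>2) \<le> \<bar>det A\<bar> ^ N / ?PA ^ 4"
      using A(2)[of "B ** A"] A(1) s by (simp add: det_mul B(1) PB)
    then have "(1 + s) ^ N \<le> (\<Prod>x\<in>X. 1 + k * c u x)\<^sup>2"
      using A(1) PA pos by (simp add: power_mult_distrib divide_simps)
    also have "\<dots> \<le> (\<Prod>x\<in>X. exp (k * c u x))\<^sup>2"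
      using pos k c0 by (intro power_mono prod_mono) (auto simp: add_nonneg_nonneg)
    also have "\<dots> = exp (2 * (k * (\<Sum>x\<in>X. c u x)))"
      using assms(1) by (simp add: exp_sum[symmetric] sum_distrib_left flip: exp_of_nat_mult)
    finally have "ln ((1 + s) ^ N) \<le> 2 * (k * (\<Sum>x\<in>X. c u x))"
      using s by (metis exp_gt_zero ln_exp ln_le_cancel_iff zero_less_power add_pos_pos zero_less_one)
    then show ?thesis
      using s by (simp add: ln_realpow k_def)
  qed
  have "real N / 4 \<le> (\<Sum>x\<in>X. c u x)" if u: "norm u = 1" for u
  proof (rule ccontr)
    assume asm: "\<not> real N / 4 \<le> (\<Sum>x\<in>X. c u x)"
    define \<sigma> where "\<sigma> = (\<Sum>x\<in>X. c u x)"
    have less: "4 * \<sigma> < real N" using asm by (simp add: \<sigma>_def)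
    have \<sigma>0: "\<sigma> \<ge> 0" by (simp add: \<sigma>_def c_def sum_nonneg)
    \<comment> \<open>Small enough to contradict optimality: with
      \<open>ln (1 + s) \<ge> s - s\<^sup>2\<close> the gap \<open>N - 4 * \<sigma>\<close> is at
      most \<open>2 * s * N\<close>, which is half of that gap.\<close>
    define s where "s = (real N - 4 * \<sigma>) / (4 * real N)"
    have s: "s > 0" "s \<le> 1" using less \<sigma>0 by (auto simp: s_def field_simps)
    have "real N * (s - s\<^sup>2) \<le> real N * ln (1 + s)"
      using s by (intro mult_left_mono ln_one_plus_pos_lower_bound) auto
    also have "\<dots> \<le> 2 * ((2 * s + s\<^sup>2) * \<sigma>)"
      using main[OF u s(1)] by (simp add: \<sigma>_def)
    finally have "s * (real N * (1 - s)) \<le> s * (2 * ((2 + s) * \<sigma>))"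
      by (simp add: power2_eq_square algebra_simps)
    then have "real N * (1 - s) \<le> 2 * ((2 + s) * \<sigma>)" using s by simp
    then have "real N - 4 * \<sigma> \<le> s * (real N + 2 * \<sigma>)" by (simp add: algebra_simps)
    also have "\<dots> \<le> s * (2 * real N)" using s less \<sigma>0 by (intro mult_left_mono) auto
    also have "\<dots> = (real N - 4 * \<sigma>) / 2" using less \<sigma>0 by (simp add: s_def)
    finally show False using less by simp
  qed
  then show ?thesis
    using that[of A] A(1) nz unfolding c_def N_def by blast
qed

subsection \<open>Positive fraction for vectors in general position\<close>

definition cols :: "real^4 \<Rightarrow> real^4 \<Rightarrow> real^4 \<Rightarrow> real^4 \<Rightarrow> real^4^4" where
  "cols x y z b = (\<chi> i j. if j = 1 then x $ i else if j = 2 then y $ i else if j = 3 then z $ i else b $ i)"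

lemma cols_mult: "cols x y z b *v c = (c $ 1) *\<^sub>R x + (c $ 2) *\<^sub>R y + (c $ 3) *\<^sub>R z + (c $ 4) *\<^sub>R b"
  by (simp add: vec_eq_iff cols_def matrix_vector_mult_def sum_4)

text \<open>Pairing a linear relation with \<open>b\<close> kills the last coefficient. Pairing it
  with \<open>\<alpha>, \<beta>, \<gamma>\<close> leaves a homogeneous system with determinant
  \<open>tri_det\<close>.\<close>

lemma det_cols_nonzero:
  assumes "tri_det x y z \<alpha> \<beta> \<gamma> \<noteq> 0" "norm b = 1" "b \<bullet> x = 0" "b \<bullet> y = 0" "b \<bullet> z = 0"
  shows "det (cols x y z b) \<noteq> 0"
proof -
  have "c = 0" if "cols x y z b *v c = 0" for c
  proof -
    have eq: "(c $ 1) *\<^sub>R x + (c $ 2) *\<^sub>R y + (c $ 3) *\<^sub>R z + (c $ 4) *\<^sub>R b = 0"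
      using that by (simp add: cols_mult)
    have "b \<bullet> ((c $ 1) *\<^sub>R x + (c $ 2) *\<^sub>R y + (c $ 3) *\<^sub>R z + (c $ 4) *\<^sub>R b) = 0"
      by (simp only: eq inner_zero_right)
    then have c4: "c $ 4 = 0"
      using assms by (simp add: inner_add_right dot_square_norm)
    have *: "(c $ 1) * (x \<bullet> \<mu>) + (c $ 2) * (y \<bullet> \<mu>) + (c $ 3) * (z \<bullet> \<mu>) = 0" for \<mu>
    proof -
      have "((c $ 1) *\<^sub>R x + (c $ 2) *\<^sub>R y + (c $ 3) *\<^sub>R z + (c $ 4) *\<^sub>R b) \<bullet> \<mu> = 0"
        by (simp only: eq inner_zero_left)
      then show ?thesis by (simp add: c4 inner_add_left)
    qed
    have "c $ 1 * tri_det x y z \<alpha> \<beta> \<gamma> = 0" "c $ 2 * tri_det x y z \<alpha> \<beta> \<gamma> = 0" "c $ 3 * tri_det x y z \<alpha> \<beta> \<gamma> = 0"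
      using *[of \<alpha>] *[of \<beta>] *[of \<gamma>] unfolding tri_det_def by algebra+
    then show ?thesis using assms(1) c4 by (simp add: vec_eq_iff forall_4)
  qed
  then show ?thesis
    by (metis invertible_det_nz invertible_left_inverse matrix_left_invertible_ker)
qed

text \<open>Cramer's rule reads the signs of coefficients off determinants, which makes their
  positivity an open condition.\<close>

lemma cols_cramer:
  "det (cols (cols x y z b *v c) y z b) = c $ 1 * det (cols x y z b)"
  "det (cols x (cols x y z b *v c) z b) = c $ 2 * det (cols x y z b)"
  "det (cols x y (cols x y z b *v c) b) = c $ 3 * det (cols x y z b)"
proof -
  have "cols (cols x y z b *v c) y z b = (\<chi> i j. if j = 1 then (cols x y z b *v c) $ i else cols x y z b $ i $ j)"
       "cols x (cols x y z b *v c) z b = (\<chi> i j. if j = 2 then (cols x y z b *v c) $ i else cols x y z b $ i $ j)"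
       "cols x y (cols x y z b *v c) b = (\<chi> i j. if j = 3 then (cols x y z b *v c) $ i else cols x y z b $ i $ j)"
    by (simp_all add: vec_eq_iff cols_def)
  then show
    "det (cols (cols x y z b *v c) y z b) = c $ 1 * det (cols x y z b)"
    "det (cols x (cols x y z b *v c) z b) = c $ 2 * det (cols x y z b)"
    "det (cols x y (cols x y z b *v c) b) = c $ 3 * det (cols x y z b)"
    by (simp_all only: cramer_lemma)
qed

lemma continuous_on_cols [continuous_intros]:
  assumes "continuous_on S f" "continuous_on S g" "continuous_on S h" "continuous_on S k"
  shows "continuous_on S (\<lambda>x. cols (f x) (g x) (h x) (k x))"
  unfolding cols_def
proof (intro continuous_on_vec_lambda)
  fix i j
  show "continuous_on S (\<lambda>x. if j = 1 then f x $ i else if j = 2 then g x $ i else if j = 3 then h x $ i else k x $ i)"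
    using assms by (cases "j = 1"; cases "j = 2"; cases "j = 3") (auto intro!: continuous_intros)
qed

text \<open>A subspace meeting the open cone of an independent triple, transversally as below, also
  meets the cones of nearby triples, and compactness extracts finitely many subspaces. The vectors
  \<open>\<alpha>, \<beta>, \<gamma>\<close> are part of the points as witnesses of width, which
  makes \<open>C\<close> closed.\<close>

lemma finite_net_for_wide_triples:
  assumes "\<tau> > 0"
  obtains \<U> :: "((real^4) \<times> (real^4)) set" where "finite \<U>"
    "\<And>x y z \<alpha> \<beta> \<gamma>. \<lbrakk>norm x = 1; norm y = 1; norm z = 1; norm \<alpha> = 1; norm \<beta> = 1; norm \<gamma> = 1;
        \<bar>tri_det x y z \<alpha> \<beta> \<gamma>\<bar> \<ge> \<tau>\<rbrakk>
      \<Longrightarrow> \<exists>(a, b) \<in> \<U>. \<exists>k l m. k > 0 \<and> l > 0 \<and> m > 0 \<and> k *\<^sub>R x + l *\<^sub>R y + m *\<^sub>R z \<in> span {a, b}"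
proof -
  let ?S = "sphere (0::real^4) 1"
  define C where "C = {(x, y, z, \<alpha>, \<beta>, \<gamma>). x \<in> ?S \<and> y \<in> ?S \<and> z \<in> ?S \<and> \<alpha> \<in> ?S \<and> \<beta> \<in> ?S \<and> \<gamma> \<in> ?S
      \<and> \<bar>tri_det x y z \<alpha> \<beta> \<gamma>\<bar> \<ge> \<tau>}"
  \<comment> \<open>By Cramer's rule the inequalities say that \<open>a\<close> has positive
    coefficients at \<open>x, y, z\<close> in the basis \<open>x, y, z, b\<close>. Subtracting its
    multiple of \<open>b\<close> yields a point of the cone in the span of \<open>a\<close> and
    \<open>b\<close>.\<close>
  define U where "U = (\<lambda>(a, b). {(x, y, z, \<alpha>::real^4, \<beta>::real^4, \<gamma>::real^4).
      0 < det (cols a y z b) * det (cols x y z b) \<and> 0 < det (cols x a z b) * det (cols x y z b)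
      \<and> 0 < det (cols x y a b) * det (cols x y z b)})"
  have comp: "compact C"
  proof -
    have "compact (?S \<times> ?S \<times> ?S \<times> ?S \<times> ?S \<times> ?S)"
      by (intro compact_Times compact_sphere)
    moreover have "closed {p :: (real^4) \<times> (real^4) \<times> (real^4) \<times> (real^4) \<times> (real^4) \<times> (real^4).
        \<tau> \<le> \<bar>tri_det (fst p) (fst (snd p)) (fst (snd (snd p))) (fst (snd (snd (snd p))))
          (fst (snd (snd (snd (snd p))))) (snd (snd (snd (snd (snd p)))))\<bar>}"
      unfolding tri_det_def by (intro closed_Collect_le continuous_intros)
    moreover have "C = (?S \<times> ?S \<times> ?S \<times> ?S \<times> ?S \<times> ?S) \<inter> {p.
        \<tau> \<le> \<bar>tri_det (fst p) (fst (snd p)) (fst (snd (snd p))) (fst (snd (snd (snd p))))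
          (fst (snd (snd (snd (snd p))))) (snd (snd (snd (snd (snd p)))))\<bar>}"
      by (auto simp: C_def)
    ultimately show ?thesis by (simp only: compact_Int_closed)
  qed
  have op: "open (U ab)" for ab
    unfolding U_def case_prod_beta by (intro open_Collect_conj open_Collect_less continuous_intros)
  have cover: "C \<subseteq> (\<Union>ab\<in>UNIV. U ab)"
  proof
    fix p assume "p \<in> C"
    then obtain x y z \<alpha> \<beta> \<gamma> where p: "p = (x, y, z, \<alpha>, \<beta>, \<gamma>)" "\<bar>tri_det x y z \<alpha> \<beta> \<gamma>\<bar> \<ge> \<tau>"
      by (auto simp: C_def)
    obtain b where b: "norm b = 1" "b \<bullet> x = 0" "b \<bullet> y = 0" "b \<bullet> z = 0"
      using unit_orthogonal_to_three by blast
    have d: "det (cols x y z b) \<noteq> 0"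
      using det_cols_nonzero[OF _ b, of \<alpha> \<beta> \<gamma>] p(2) assms by auto
    \<comment> \<open>This makes \<open>a\<close> equal to \<open>x + y + z\<close>, and all three
      products become the square of one determinant.\<close>
    define c :: "real^4" where "c = (\<chi> k. if k = 4 then 0 else 1)"
    have c: "c $ 1 = 1" "c $ 2 = 1" "c $ 3 = 1" by (simp_all add: c_def)
    have "p \<in> U (cols x y z b *v c, b)"
      using d by (simp add: U_def p(1) cols_cramer c mult_pos_pos flip: power2_eq_square)
    then show "p \<in> (\<Union>ab\<in>UNIV. U ab)" by blast
  qed
  obtain \<U> where "\<U> \<subseteq> UNIV" and \<U>: "finite \<U>" "C \<subseteq> (\<Union>ab\<in>\<U>. U ab)"
    by (rule compactE_image[OF comp op cover])
  show ?thesis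
  proof (rule that[OF \<U>(1)])
    fix x y z \<alpha> \<beta> \<gamma> :: "real^4"
    assume "norm x = 1" "norm y = 1" "norm z = 1" "norm \<alpha> = 1" "norm \<beta> = 1" "norm \<gamma> = 1"
      "\<bar>tri_det x y z \<alpha> \<beta> \<gamma>\<bar> \<ge> \<tau>"
    then have "(x, y, z, \<alpha>, \<beta>, \<gamma>) \<in> C" by (simp add: C_def)
    then have "(x, y, z, \<alpha>, \<beta>, \<gamma>) \<in> (\<Union>ab\<in>\<U>. U ab)" by (rule subsetD[OF \<U>(2)])
    then obtain a b where ab: "(a, b) \<in> \<U>" "(x, y, z, \<alpha>, \<beta>, \<gamma>) \<in> U (a, b)"
      by (elim UN_E) (metis surj_pair)
    define M where "M = cols x y z b"
    have pos: "0 < det (cols a y z b) * det M" "0 < det (cols x a z b) * det M" "0 < det (cols x y a b) * det M"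
      using ab(2) by (simp_all add: U_def M_def)
    then have "det M \<noteq> 0" by auto
    then obtain c where c: "M *v c = a"
      using cramer[of M] by blast
    have "0 < (c $ 1) * (det M)\<^sup>2" "0 < (c $ 2) * (det M)\<^sup>2" "0 < (c $ 3) * (det M)\<^sup>2"
      using pos cols_cramer[of x y z b c] unfolding M_def[symmetric] c by (simp_all add: power2_eq_square mult.assoc)
    then have "c $ 1 > 0" "c $ 2 > 0" "c $ 3 > 0"
      by (simp_all add: zero_less_mult_iff)
    moreover have "(c $ 1) *\<^sub>R x + (c $ 2) *\<^sub>R y + (c $ 3) *\<^sub>R z \<in> span {a, b}"
    proof -
      have "(c $ 1) *\<^sub>R x + (c $ 2) *\<^sub>R y + (c $ 3) *\<^sub>R z = a - (c $ 4) *\<^sub>R b"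
        using c unfolding M_def cols_mult by (simp add: algebra_simps)
      then show ?thesis by (simp add: span_base span_diff span_scale)
    qed
    ultimately show "\<exists>(a, b) \<in> \<U>. \<exists>k l m. k > 0 \<and> l > 0 \<and> m > 0 \<and> k *\<^sub>R x + l *\<^sub>R y + m *\<^sub>R z \<in> span {a, b}"
      using ab(1) by blast
  qed
qed

section \<open>Double counting and pigeonhole\<close>

lemma sum_offdiagonal:
  fixes h :: "nat \<Rightarrow> nat \<Rightarrow> real"
  assumes "\<And>i j. h i j = h j i"
  shows "(\<Sum>i<n. \<Sum>j<n. if i \<noteq> j then h i j else 0) = 2 * (\<Sum>(i, j)\<in>{(i, j). i < j \<and> j < n}. h i j)"
proof -
  let ?X = "{(i, j). i < j \<and> j < n}" and ?Y = "{(i, j). j < i \<and> i < n}"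
  have fin: "finite ?X" "finite ?Y"
    by (rule finite_subset[of _ "{..<n} \<times> {..<n}"], auto)+
  have "(\<Sum>i<n. \<Sum>j<n. if i \<noteq> j then h i j else 0) = (\<Sum>(i, j)\<in>{..<n} \<times> {..<n}. if i \<noteq> j then h i j else 0)"
    by (simp add: sum.cartesian_product)
  also have "\<dots> = (\<Sum>(i, j)\<in>?X \<union> ?Y. h i j)"
    by (rule sum.mono_neutral_cong_right) (auto split: if_splits)
  also have "\<dots> = (\<Sum>(i, j)\<in>?X. h i j) + (\<Sum>(i, j)\<in>?Y. h i j)"
    using fin by (intro sum.union_disjoint) auto
  also have "(\<Sum>(i, j)\<in>?Y. h i j) = (\<Sum>(i, j)\<in>?X. h i j)"
    by (rule sum.reindex_bij_witness[of _ prod.swap prod.swap]) (auto intro: assms)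
  finally show ?thesis by simp
qed

lemma pigeonhole_real:
  assumes "finite S" "finite T" "\<And>s. s \<in> S \<Longrightarrow> \<exists>t\<in>T. P s t" "S \<noteq> {}"
  obtains t where "t \<in> T" "real (card S) \<le> real (card T) * real (card {s \<in> S. P s t})"
proof (rule ccontr)
  note witness = that
  assume neg: "\<not> thesis"
  have less: "real (card T) * real (card {s \<in> S. P s t}) < real (card S)" if t: "t \<in> T" for t
    using witness[OF t] neg not_le by blast
  have "T \<noteq> {}" using assms(3,4) by blast
  then have T: "card T > 0" using assms(2) by (simp add: card_gt_0_iff)
  have "S \<subseteq> (\<Union>t\<in>T. {s \<in> S. P s t})" using assms(3) by blast
  then have "card S \<le> card (\<Union>t\<in>T. {s \<in> S. P s t})"
    using assms(1,2) by (intro card_mono) auto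
  also have "\<dots> \<le> (\<Sum>t\<in>T. card {s \<in> S. P s t})"
    using assms(2) by (rule card_UN_le)
  finally have "real (card S) \<le> (\<Sum>t\<in>T. real (card {s \<in> S. P s t}))"
    by (metis of_nat_le_iff of_nat_sum)
  also have "\<dots> < (\<Sum>t\<in>T. real (card S) / real (card T))"
    using less T \<open>T \<noteq> {}\<close> assms(2) by (intro sum_strict_mono) (auto simp: field_simps)
  also have "\<dots> = real (card S)" using T by simp
  finally show False by simp
qed

text \<open>For orthonormal \<open>f\<close> and \<open>g\<close> the common zero set is a
  two-dimensional subspace, hence a projective line, given as the axis of the pencil of hyperplanes
  through it.\<close>

definition pencil_hits :: "real^4 \<Rightarrow> real^4 \<Rightarrow> (real^4) set \<Rightarrow> bool" where
  "pencil_hits f g V \<longleftrightarrow> (\<exists>z \<in> convex hull V. z \<bullet> f = 0 \<and> z \<bullet> g = 0)"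

text \<open>The subspace is pulled back through \<open>A\<close>, so \<open>f\<close> and
  \<open>g\<close> depend on \<open>A, a, b\<close> only and serve all stars at once. The norms are
  positive and are absorbed into the coefficients, which are then scaled to sum 1.\<close>

lemma pencil_through_wide_stars:
  fixes A :: "real^4^4"
  assumes "det A \<noteq> 0"
  obtains f g where "norm f = 1" "norm g = 1" "f \<bullet> g = 0"
    "\<And>V x y z k l m. \<lbrakk>x \<in> V; y \<in> V; z \<in> V; k > 0; l > 0; m > 0; A *v x \<noteq> 0; A *v y \<noteq> 0; A *v z \<noteq> 0;
       k *\<^sub>R ((A *v x) /\<^sub>R norm (A *v x)) + l *\<^sub>R ((A *v y) /\<^sub>R norm (A *v y)) + m *\<^sub>R ((A *v z) /\<^sub>R norm (A *v z))
         \<in> span {a, b}\<rbrakk> \<Longrightarrow> pencil_hits f g V"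
proof -
  obtain B where B: "B ** A = mat 1"
    using assms by (metis invertible_det_nz invertible_left_inverse)
  obtain f g where fg: "norm f = 1" "norm g = 1" "f \<bullet> g = 0" "f \<bullet> (B *v a) = 0" "f \<bullet> (B *v b) = 0" "g \<bullet> (B *v a) = 0" "g \<bullet> (B *v b) = 0"
    using orthonormal_pair_orthogonal_to by blast
  show ?thesis
  proof (rule that[OF fg(1-3)])
    fix V x y z and k l m :: real
    assume V: "x \<in> V" "y \<in> V" "z \<in> V" and pos: "k > 0" "l > 0" "m > 0"
      and nz: "A *v x \<noteq> 0" "A *v y \<noteq> 0" "A *v z \<noteq> 0"
      and span: "k *\<^sub>R ((A *v x) /\<^sub>R norm (A *v x)) + l *\<^sub>R ((A *v y) /\<^sub>R norm (A *v y)) + m *\<^sub>R ((A *v z) /\<^sub>R norm (A *v z)) \<in> span {a, b}"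
    define k' l' m' where "k' = k / norm (A *v x)" and "l' = l / norm (A *v y)" and "m' = m / norm (A *v z)"
    have pos': "k' > 0" "l' > 0" "m' > 0" using pos nz by (simp_all add: k'_def l'_def m'_def)
    define p where "p = k' *\<^sub>R x + l' *\<^sub>R y + m' *\<^sub>R z"
    have "A *v p \<in> span {a, b}"
      using span by (simp add: p_def k'_def l'_def m'_def matrix_vector_right_distrib matrix_vector_mult_scaleR divide_inverse)
    then obtain s t where "A *v p = s *\<^sub>R a + t *\<^sub>R b"
      by (auto simp: span_insert span_breakdown_eq algebra_simps)
    then have "B *v (A *v p) = s *\<^sub>R (B *v a) + t *\<^sub>R (B *v b)"
      by (simp add: matrix_vector_right_distrib matrix_vector_mult_scaleR)
    moreover have "B *v (A *v p) = p" by (simp add: matrix_vector_mul_assoc B)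
    ultimately have p: "p \<bullet> f = 0" "p \<bullet> g = 0"
      using fg by (simp_all add: inner_add_right inner_commute)
    define \<sigma> where "\<sigma> = k' + l' + m'"
    have \<sigma>: "\<sigma> > 0" using pos' by (simp add: \<sigma>_def)
    have "p /\<^sub>R \<sigma> = (k' / \<sigma>) *\<^sub>R x + (l' / \<sigma>) *\<^sub>R y + (m' / \<sigma>) *\<^sub>R z"
      by (simp add: p_def scaleR_add_right divide_inverse mult.commute)
    moreover have "\<dots> \<in> convex hull V"
    proof -
      have "k' / \<sigma> + l' / \<sigma> + m' / \<sigma> = 1"
        using \<sigma> by (simp add: \<sigma>_def flip: add_divide_distrib)
      moreover have "0 \<le> k' / \<sigma>" "0 \<le> l' / \<sigma>" "0 \<le> m' / \<sigma>" using pos' \<sigma> by simp_all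
      ultimately have "(k' / \<sigma>) *\<^sub>R x + (l' / \<sigma>) *\<^sub>R y + (m' / \<sigma>) *\<^sub>R z \<in> convex hull {x, y, z}"
        unfolding convex_hull_3 by blast
      then show ?thesis using hull_mono[of "{x, y, z}" V] V by blast
    qed
    ultimately have "p /\<^sub>R \<sigma> \<in> convex hull V" by simp
    moreover have "(p /\<^sub>R \<sigma>) \<bullet> f = 0" "(p /\<^sub>R \<sigma>) \<bullet> g = 0" using p by simp_all
    ultimately show "pencil_hits f g V"
      unfolding pencil_hits_def by blast
  qed
qed

lemma generic_positive_fraction:
  "\<exists>c::real. c > 0 \<and> (\<forall>n v. 1000 \<le> n \<longrightarrow> (\<forall>i j. v i j = v j i)
      \<longrightarrow> generic_vectors {(i, j). i < j \<and> j < n} (\<lambda>(i, j). v i j)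
      \<longrightarrow> (\<exists>f g. norm f = 1 \<and> norm g = 1 \<and> f \<bullet> g = 0
            \<and> c * real n \<le> real (card {i. i < n \<and> pencil_hits f g (v i ` ({..<n} - {i}))})))"
proof -
  have "0 < 1 / (10::real)^18" by simp
  then obtain \<U> :: "((real^4) \<times> (real^4)) set" where \<U>: "finite \<U>"
    "\<And>x y z \<alpha> \<beta> \<gamma>. \<lbrakk>norm x = 1; norm y = 1; norm z = 1; norm \<alpha> = 1; norm \<beta> = 1; norm \<gamma> = 1;
        \<bar>tri_det x y z \<alpha> \<beta> \<gamma>\<bar> \<ge> 1 / 10^18\<rbrakk>
      \<Longrightarrow> \<exists>(a, b) \<in> \<U>. \<exists>k l m. k > 0 \<and> l > 0 \<and> m > 0 \<and> k *\<^sub>R x + l *\<^sub>R y + m *\<^sub>R z \<in> span {a, b}"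
    by (rule finite_net_for_wide_triples) (rule that, assumption, blast)
  \<comment> \<open>The numerator is the fraction separating the two cases below and
    \<open>card \<U>\<close> is the pigeonhole loss; adding 1 keeps the denominator
    positive.\<close>
  define c where "c = 3 / 10000 / (real (card \<U>) + 1)"
  have c: "c > 0" by (simp add: c_def add_nonneg_pos)
  show ?thesis
  proof (intro exI[of _ c] conjI c allI impI)
    fix n and v :: "nat \<Rightarrow> nat \<Rightarrow> real^4"
    assume n: "1000 \<le> n" and "\<forall>i j. v i j = v j i"
      and gen: "generic_vectors {(i, j). i < j \<and> j < n} (\<lambda>(i, j). v i j)"
    have sym: "v i j = v j i" for i j using \<open>\<forall>i j. v i j = v j i\<close> by blast
    let ?X = "{(i, j). i < j \<and> j < n}"
    have finX: "finite ?X"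
      by (rule finite_subset[of _ "{..<n} \<times> {..<n}"]) auto
    have cardX: "2 * real (card ?X) = real n * (real n - 1)"
    proof -
      have "2 * real (card ?X) = (\<Sum>i<n. \<Sum>j<n. if i \<noteq> j then 1 else 0)"
        by (subst sum_offdiagonal) simp_all
      also have "\<dots> = (\<Sum>i<n. real n - 1)"
      proof (intro sum.cong refl)
        fix i assume "i \<in> {..<n}"
        moreover have "(\<Sum>j<n. if i \<noteq> j then 1 else 0::real) = real (card ({..<n} - {i}))"
          by (simp add: sum.If_cases Collect_neg_eq Diff_eq)
        ultimately show "(\<Sum>j<n. if i \<noteq> j then 1 else 0::real) = real n - 1"
          by (simp add: of_nat_diff)
      qed
      finally show ?thesis by simp
    qed
    have "real n * (real n - 1) \<ge> 1000 * 999"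
      using n by (intro mult_mono) auto
    then have "card ?X > 4" using cardX by linarith
    then obtain A :: "real^4^4" where A: "det A \<noteq> 0"
      "\<And>x. x \<in> ?X \<Longrightarrow> A *v (case x of (i, j) \<Rightarrow> v i j) \<noteq> 0"
      "\<And>u. norm u = 1 \<Longrightarrow> real (card ?X) / 4 \<le> (\<Sum>x\<in>?X. (((A *v (case x of (i, j) \<Rightarrow> v i j)) /\<^sub>R norm (A *v (case x of (i, j) \<Rightarrow> v i j))) \<bullet> u)\<^sup>2)"
      using radial_isotropic_position[OF finX _ gen] by blast
    define w where "w i j = (A *v v i j) /\<^sub>R norm (A *v v i j)" for i j
    have w_sym: "w i j = w j i" for i j by (simp add: w_def sym)
    have nz: "A *v v i j \<noteq> 0" if "i < n" "j < n" "i \<noteq> j" for i j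
      using A(2)[of "(i, j)"] A(2)[of "(j, i)"] that sym[of i j] by (cases "i < j") auto
    have w_unit: "norm (w i j) = 1" if "i < n" "j < n" "i \<noteq> j" for i j
      using nz[OF that] by (simp add: w_def)
    have w_iso: "real n * (real n - 1) / 4 \<le> (\<Sum>i<n. \<Sum>j<n. if i \<noteq> j then (w i j \<bullet> u)\<^sup>2 else 0)" if "norm u = 1" for u
      using A(3)[OF that] cardX
      by (subst sum_offdiagonal) (simp_all add: w_sym[of _ _] w_def case_prod_beta sym)
    \<comment> \<open>The indices that are not thin. The strict inequality gives the remaining ones
      exactly the bound of the locale.\<close>
    define bad where "bad = {i. i < n \<and> (\<exists>j k l \<alpha> \<beta> \<gamma>. {j, k, l} \<subseteq> {..<n} - {i} \<and> norm \<alpha> = 1 \<and> norm \<beta> = 1 \<and> norm \<gamma> = 1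
        \<and> 1 / 10^18 < \<bar>tri_det (w i j) (w i k) (w i l) \<alpha> \<beta> \<gamma>\<bar>)}"
    have bad: "finite bad" "bad \<subseteq> {..<n}" by (auto simp: bad_def)
    show "\<exists>f g. norm f = 1 \<and> norm g = 1 \<and> f \<bullet> g = 0
            \<and> c * real n \<le> real (card {i. i < n \<and> pencil_hits f g (v i ` ({..<n} - {i}))})"
    proof (cases "real (card bad) \<ge> 3 / 10000 * n")
      case True
      define hit where "hit i ab = (\<exists>j k l p q r. {j, k, l} \<subseteq> {..<n} - {i} \<and> p > 0 \<and> q > 0 \<and> r > (0::real)
          \<and> p *\<^sub>R w i j + q *\<^sub>R w i k + r *\<^sub>R w i l \<in> span {fst ab, snd ab})" for i and ab :: "(real^4) \<times> (real^4)"
      have ex: "\<exists>ab\<in>\<U>. hit i ab" if i_bad: "i \<in> bad" for i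
      proof -
        obtain j k l \<alpha> \<beta> \<gamma> where i: "i < n" "{j, k, l} \<subseteq> {..<n} - {i}" and u: "norm \<alpha> = 1" "norm \<beta> = 1" "norm \<gamma> = 1"
          and large: "1 / 10^18 < \<bar>tri_det (w i j) (w i k) (w i l) \<alpha> \<beta> \<gamma>\<bar>"
          using i_bad unfolding bad_def by blast
        have "norm (w i j) = 1" "norm (w i k) = 1" "norm (w i l) = 1"
          using w_unit i by auto
        from \<U>(2)[OF this u less_imp_le[OF large]]
        obtain a b p q r where ab: "(a, b) \<in> \<U>" and pos: "p > 0" "q > 0" "r > (0::real)"
          and span: "p *\<^sub>R w i j + q *\<^sub>R w i k + r *\<^sub>R w i l \<in> span {a, b}" by blast
        have "hit i (a, b)"
          unfolding hit_def fst_conv snd_conv using i(2) pos span by blast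
        then show ?thesis using ab by blast
      qed
      have "bad \<noteq> {}" using True n by auto
      then obtain ab where ab: "ab \<in> \<U>" "real (card bad) \<le> real (card \<U>) * real (card {i \<in> bad. hit i ab})"
        using pigeonhole_real[of bad \<U> hit] bad(1) \<U>(1) ex by blast
      obtain f g where fg: "norm f = 1" "norm g = 1" "f \<bullet> g = 0"
        "\<And>V x y z k l m. \<lbrakk>x \<in> V; y \<in> V; z \<in> V; k > 0; l > 0; m > 0; A *v x \<noteq> 0; A *v y \<noteq> 0; A *v z \<noteq> 0;
           k *\<^sub>R ((A *v x) /\<^sub>R norm (A *v x)) + l *\<^sub>R ((A *v y) /\<^sub>R norm (A *v y)) + m *\<^sub>R ((A *v z) /\<^sub>R norm (A *v z))
             \<in> span {fst ab, snd ab}\<rbrakk> \<Longrightarrow> pencil_hits f g V"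
        by (rule pencil_through_wide_stars[OF A(1)]) (rule that, assumption, assumption, assumption, blast)
      have "{i \<in> bad. hit i ab} \<subseteq> {i. i < n \<and> pencil_hits f g (v i ` ({..<n} - {i}))}" (is "?L \<subseteq> ?R")
      proof
        fix i assume "i \<in> ?L"
        then obtain j k l p q r where i: "i < n" "{j, k, l} \<subseteq> {..<n} - {i}" and pos: "p > 0" "q > 0" "r > (0::real)"
          and span: "p *\<^sub>R w i j + q *\<^sub>R w i k + r *\<^sub>R w i l \<in> span {fst ab, snd ab}"
          using bad(2) unfolding hit_def by blast
        have "pencil_hits f g (v i ` ({..<n} - {i}))"
          by (rule fg(4)[of "v i j" _ "v i k" "v i l" p q r]) (use i pos span nz in \<open>auto simp: w_def\<close>)
        then show "i \<in> ?R" using i(1) by simp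
      qed
      then have "real (card ?L) \<le> real (card ?R)"
        by (intro of_nat_mono card_mono) auto
      moreover have "c * real n \<le> real (card ?L)"
      proof -
        have "3 / 10000 * n \<le> (real (card \<U>) + 1) * real (card ?L)"
          using True ab(2) by (simp add: algebra_simps)
        then show ?thesis by (simp add: c_def field_simps)
      qed
      ultimately have "c * real n \<le> real (card ?R)" by linarith
      then show ?thesis using fg(1-3) by blast
    next
      case False
      define G where "G = {..<n} - bad"
      define w' where "w' i j = (if i \<in> G \<and> j \<in> G \<and> i \<noteq> j then w i j else 0)" for i j
      interpret thin_isotropic_system n G w'
      proof
        show "1000 \<le> n" by (rule n)
        show "G \<subseteq> {..<n}" by (auto simp: G_def)
        show "w' i j = w' j i" for i j by (auto simp: w'_def w_sym[of i j])
        show "norm (w' i j) = 1" if "i \<in> G" "j \<in> G" "i \<noteq> j" for i j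
          using that w_unit by (simp add: w'_def G_def)
        show "w' i j = 0" if "i \<notin> G \<or> j \<notin> G \<or> i = j" for i j
          using that by (auto simp: w'_def)
        show "\<bar>tri_det (w' i j) (w' i k) (w' i l) a b d\<bar> \<le> 1 / 10^18"
          if i: "i \<in> G" and u: "norm a = 1" "norm b = 1" "norm d = 1" for i j k l a b d
        proof (cases "{j, k, l} \<subseteq> G - {i}")
          case True
          then have jkl: "{j, k, l} \<subseteq> {..<n} - {i}" "w' i j = w i j" "w' i k = w i k" "w' i l = w i l"
            using i by (auto simp: w'_def G_def)
          have "i < n" "i \<notin> bad" using i by (auto simp: G_def)
          show ?thesis
          proof (rule ccontr)
            assume "\<not> ?thesis"
            then have "1 / 10^18 < \<bar>tri_det (w i j) (w i k) (w i l) a b d\<bar>"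
              unfolding jkl(2-4) not_le .
            then have "i \<in> bad"
              unfolding bad_def using \<open>i < n\<close> jkl(1) u by blast
            then show False using \<open>i \<notin> bad\<close> by blast
          qed
        next
          case False
          then have "w' i j = 0 \<or> w' i k = 0 \<or> w' i l = 0" by (auto simp: w'_def)
          then show ?thesis by (auto simp: tri_det_def)
        qed
        show "249/1000 * (real n)\<^sup>2 \<le> (\<Sum>i<n. \<Sum>j<n. (w' i j \<bullet> u)\<^sup>2)" if u: "norm u = 1" for u
        proof -
          let ?I = "\<lambda>i. if i \<in> bad then 1 else 0::real"
          have "(if i \<noteq> j then (w i j \<bullet> u)\<^sup>2 else 0) \<le> (w' i j \<bullet> u)\<^sup>2 + (?I i + ?I j)" if "i < n" "j < n" for i j
          proof -
            have "(w i j \<bullet> u)\<^sup>2 \<le> 1" if "i \<noteq> j"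
              using abs_inner_le_1[of "w i j" u] w_unit[OF \<open>i < n\<close> \<open>j < n\<close> that] u by (simp add: abs_square_le_1)
            then show ?thesis using that by (auto simp: w'_def G_def add_increasing)
          qed
          then have "(\<Sum>i<n. \<Sum>j<n. if i \<noteq> j then (w i j \<bullet> u)\<^sup>2 else 0) \<le> (\<Sum>i<n. \<Sum>j<n. (w' i j \<bullet> u)\<^sup>2 + (?I i + ?I j))"
            by (intro sum_mono) auto
          also have "\<dots> = (\<Sum>i<n. \<Sum>j<n. (w' i j \<bullet> u)\<^sup>2) + 2 * (real n * real (card bad))"
            using bad by (simp add: sum.distrib sum.If_cases Int_absorb1 flip: sum_distrib_left)
          finally have *: "real n * (real n - 1) / 4 \<le> (\<Sum>i<n. \<Sum>j<n. (w' i j \<bullet> u)\<^sup>2) + 2 * (real n * real (card bad))"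
            using w_iso[OF u] by linarith
          \<comment> \<open>Out of \<open>1/4\<close>, discarding bad rows and columns costs at most
            \<open>6/10000\<close> and the missing diagonal at most \<open>1/4000\<close>, which
            leaves more than \<open>249/1000\<close>.\<close>
          have "real n * real (card bad) \<le> real n * (3 / 10000 * real n)"
            using False by (intro mult_left_mono) auto
          moreover have "real n * 1000 \<le> real n * real n"
            using n by (intro mult_left_mono) auto
          ultimately show ?thesis
            using * by (simp add: power2_eq_square algebra_simps)
        qed
      qed
      show ?thesis using contradiction by blast
    qed
  qed
qed

subsection \<open>Removing general position\<close>

text \<open>The vectors are chosen one at a time, each avoiding the spans of at most three earlier
  ones; these spans form a finite union of null sets.\<close>

lemma generic_perturbation:
  fixes v :: "'i \<Rightarrow> real^4"
  assumes "finite X" "\<epsilon> > 0"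
  obtains u where "generic_vectors X u" "\<And>x. x \<in> X \<Longrightarrow> norm (u x - v x) < \<epsilon>"
proof -
  \<comment> \<open>Injectivity is carried along because an image set forgets repetitions, and four
    distinct indices must give four vectors.\<close>
  have "\<exists>u. (\<forall>x\<in>X. norm (u x - v x) < \<epsilon>) \<and> (\<forall>Y\<subseteq>X. card Y \<le> 4 \<longrightarrow> inj_on u Y \<and> independent (u ` Y))"
    using assms(1)
  proof induction
    case empty
    then show ?case by (auto simp: independent_empty)
  next
    case (insert x X)
    then obtain u where u: "\<And>y. y \<in> X \<Longrightarrow> norm (u y - v y) < \<epsilon>"
      "\<And>Y. Y \<subseteq> X \<Longrightarrow> card Y \<le> 4 \<Longrightarrow> inj_on u Y \<and> independent (u ` Y)"
      by blast
    define B where "B = (\<Union>Y\<in>{Y. Y \<subseteq> X \<and> card Y \<le> 3}. span (u ` Y))"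
    have "negligible B"
      unfolding B_def
    proof (rule negligible_Union)
      show "finite ((\<lambda>Y. span (u ` Y)) ` {Y. Y \<subseteq> X \<and> card Y \<le> 3})"
        using insert.hyps(1) by (auto intro: finite_subset[of _ "Pow X"])
      fix T assume "T \<in> (\<lambda>Y. span (u ` Y)) ` {Y. Y \<subseteq> X \<and> card Y \<le> 3}"
      then obtain Y where Y: "Y \<subseteq> X" "card Y \<le> 3" and T: "T = span (u ` Y)" by blast
      have "finite Y" using Y(1) insert.hyps(1) finite_subset by blast
      then have "dim (u ` Y) \<le> card (u ` Y)" by (intro dim_le_card) (auto simp: span_base)
      also have "\<dots> \<le> 3" using card_image_le[OF \<open>finite Y\<close>, of u] Y(2) by linarith
      finally show "negligible T" unfolding T by (intro negligible_lowdim) simp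
    qed
    moreover have "\<not> negligible (ball (v x) \<epsilon>)"
      using assms(2) by (intro open_not_negligible) auto
    ultimately obtain p where p: "p \<in> ball (v x) \<epsilon>" "p \<notin> B"
      using negligible_subset by blast
    define u' where "u' = u(x := p)"
    have eq: "u' ` Y = u ` Y" "inj_on u' Y = inj_on u Y" if "Y \<subseteq> X" for Y
      using that insert.hyps(2) by (auto simp: u'_def inj_on_def)
    show ?case
    proof (intro exI[of _ u'] conjI ballI allI impI)
      fix y assume "y \<in> insert x X"
      then show "norm (u' y - v y) < \<epsilon>"
        using u(1) p(1) insert.hyps(2) by (auto simp: u'_def dist_norm norm_minus_commute)
    next
      fix Y assume Y: "Y \<subseteq> insert x X" "card Y \<le> 4"
      have "inj_on u' Y \<and> independent (u' ` Y)"
      proof (cases "x \<in> Y")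
        case False
        then have "Y \<subseteq> X" using Y(1) by blast
        then show ?thesis using u(2) Y(2) eq by simp
      next
        case True
        define Z where "Z = Y - {x}"
        have finY: "finite Y" using Y(1) insert.hyps(1) finite_subset by blast
        have Z: "Z \<subseteq> X" "card Z \<le> 3" "Y = insert x Z" "x \<notin> Z"
          using Y True finY by (auto simp: Z_def)
        have "p \<notin> span (u ` Z)" using p(2) Z unfolding B_def by blast
        moreover have "inj_on u Z" "independent (u ` Z)" using u(2)[of Z] Z by auto
        moreover have "u' ` Y = insert p (u ` Z)" using Z eq(1)[of Z] by (simp add: u'_def)
        moreover have "p \<notin> u ` Z" using \<open>p \<notin> span (u ` Z)\<close> span_base[of p "u ` Z"] by blast
        moreover have "u' x = p" "inj_on u' Z" using \<open>inj_on u Z\<close> eq(2)[OF Z(1)] by (simp_all add: u'_def)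
        ultimately show ?thesis
          using Z(3,4) eq(1)[OF Z(1)] by (simp add: independent_insert)
      qed
      then show "inj_on u' Y" "independent (u' ` Y)" by auto
    qed
  qed
  then obtain u where u: "\<And>x. x \<in> X \<Longrightarrow> norm (u x - v x) < \<epsilon>"
    "\<And>Y. Y \<subseteq> X \<Longrightarrow> card Y \<le> 4 \<Longrightarrow> inj_on u Y \<and> independent (u ` Y)" by blast
  have "det (\<chi> k. u (f k)) \<noteq> 0" if f: "inj f" "range f \<subseteq> X" for f :: "4 \<Rightarrow> 'i"
  proof -
    let ?M = "\<chi> k. u (f k)"
    have "card (range f) = 4" using card_image[OF f(1)] by simp
    then have ind: "inj_on u (range f)" "independent (u ` range f)" using u(2)[OF f(2)] by auto
    have inj: "inj (\<lambda>k. u (f k))" using ind(1) f(1) by (auto simp: inj_on_def)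
    have invf: "inv (\<lambda>k. u (f k)) (u (f k)) = k" for k using inv_f_f[OF inj, of k] by simp
    have "c = 0" if "transpose ?M *v c = 0" for c
    proof -
      have "(\<Sum>k\<in>UNIV. (c $ k) *\<^sub>R u (f k)) = 0"
        using that by (simp add: vec_eq_iff matrix_vector_mult_def transpose_def mult.commute)
      moreover have "(\<Sum>k\<in>UNIV. (c $ k) *\<^sub>R u (f k)) = (\<Sum>y\<in>range (\<lambda>k. u (f k)). (c $ (inv (\<lambda>k. u (f k)) y)) *\<^sub>R y)"
        using inj by (simp add: sum.reindex invf)
      moreover have "range (\<lambda>k. u (f k)) = u ` range f" by auto
      ultimately have "(\<Sum>y\<in>u ` range f. (c $ (inv (\<lambda>k. u (f k)) y)) *\<^sub>R y) = 0" by simp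
      then have "c $ (inv (\<lambda>k. u (f k)) (u (f k))) = 0" for k
        by (intro independentD[OF ind(2) _ subset_refl]) auto
      then have "c $ k = 0" for k by (simp add: invf)
      then show ?thesis by (simp add: vec_eq_iff)
    qed
    then have "det (transpose ?M) \<noteq> 0"
      by (metis invertible_det_nz invertible_left_inverse matrix_left_invertible_ker)
    then show ?thesis by (simp add: det_transpose)
  qed
  then show ?thesis using that[of u] u(1) unfolding generic_vectors_def by blast
qed

text \<open>The sum of the hull of the \<open>v j\<close> and a closed ball is convex and contains
  every \<open>u j\<close>.\<close>

lemma convex_hull_perturbation:
  fixes u v :: "'i \<Rightarrow> 'a::real_normed_vector"
  assumes "z \<in> convex hull (u ` J)" "\<And>j. j \<in> J \<Longrightarrow> norm (u j - v j) \<le> \<epsilon>"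
  obtains z' where "z' \<in> convex hull (v ` J)" "norm (z - z') \<le> \<epsilon>"
proof -
  let ?S = "\<Union>x\<in>convex hull (v ` J). \<Union>y\<in>cball 0 \<epsilon>. {x + y}"
  have "convex ?S" by (intro convex_sums convex_convex_hull convex_cball)
  moreover have "u ` J \<subseteq> ?S"
  proof
    fix p assume "p \<in> u ` J"
    then obtain j where j: "j \<in> J" "p = u j" by blast
    have "v j \<in> convex hull (v ` J)" using j by (simp add: hull_inc)
    moreover have "u j - v j \<in> cball 0 \<epsilon>" using assms(2)[OF j(1)] by simp
    moreover have "p = v j + (u j - v j)" using j by simp
    ultimately show "p \<in> ?S" by blast
  qed
  ultimately have "convex hull (u ` J) \<subseteq> ?S" by (intro hull_minimal)
  then obtain x y where "x \<in> convex hull (v ` J)" "norm y \<le> \<epsilon>" "z = x + y"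
    using assms(1) by auto
  then show ?thesis using that[of x] by simp
qed

text \<open>Perturbations of size tending to zero give pencils that converge along a subsequence.
  One set of hit indices recurs infinitely often, and its incidences survive in the limit because
  the hulls are compact.\<close>

lemma positive_fraction:
  "\<exists>c::real. c > 0 \<and> (\<forall>n v. 1000 \<le> n \<longrightarrow> (\<forall>i j. v i j = v j i)
      \<longrightarrow> (\<exists>f g. norm f = 1 \<and> norm g = 1 \<and> f \<bullet> g = 0
            \<and> c * real n \<le> real (card {i. i < n \<and> pencil_hits f g (v i ` ({..<n} - {i}))})))"
proof -
  obtain c :: real where c: "c > 0"
    and generic: "\<forall>n v. 1000 \<le> n \<longrightarrow> (\<forall>i j. v i j = v j i)
      \<longrightarrow> generic_vectors {(i, j). i < j \<and> j < n} (\<lambda>(i, j). v i j)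
      \<longrightarrow> (\<exists>f g. norm f = 1 \<and> norm g = 1 \<and> f \<bullet> g = 0
            \<and> c * real n \<le> real (card {i. i < n \<and> pencil_hits f g (v i ` ({..<n} - {i}))}))"
    using generic_positive_fraction by (elim exE conjE) (rule that)
  show ?thesis
  proof (intro exI[of _ c] conjI c allI impI)
    fix n :: nat and v :: "nat \<Rightarrow> nat \<Rightarrow> real^4"
    assume n: "1000 \<le> n" and sym: "\<forall>i j. v i j = v j i"
    let ?X = "{(i, j). i < j \<and> j < n}"
    have finX: "finite ?X"
      by (rule finite_subset[of _ "{..<n} \<times> {..<n}"]) auto
    let ?J = "\<lambda>i. {..<n} - {i}"
    define Q where "Q k f g u \<longleftrightarrow> norm f = 1 \<and> norm g = 1 \<and> f \<bullet> g = 0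
        \<and> (\<forall>i<n. \<forall>j<n. i \<noteq> j \<longrightarrow> norm (u i j - v i j) \<le> 1 / real (Suc k))
        \<and> c * real n \<le> real (card {i. i < n \<and> pencil_hits f g (u i ` ?J i)})" for k f g u
    have "\<exists>f g u. Q k f g u" for k
    proof -
      obtain u where u: "generic_vectors ?X u" "\<And>x. x \<in> ?X \<Longrightarrow> norm (u x - (\<lambda>(i, j). v i j) x) < 1 / real (Suc k)"
        by (rule generic_perturbation[OF finX, of "1 / real (Suc k)" "\<lambda>(i, j). v i j"], simp) (rule that, assumption, blast)
      \<comment> \<open>The perturbation is controlled on increasing pairs only, and this
        symmetrises it. Stars never use the diagonal.\<close>
      define u' where "u' i j = u (min i j, max i j)" for i j
      have s: "\<forall>i j. u' i j = u' j i" by (simp add: u'_def min.commute max.commute)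
      have "generic_vectors ?X (\<lambda>(i, j). u' i j)"
        unfolding generic_vectors_def
      proof (intro allI impI)
        fix f :: "4 \<Rightarrow> nat \<times> nat" assume f: "inj f \<and> range f \<subseteq> ?X"
        have "(\<lambda>(i, j). u' i j) (f k) = u (f k)" for k
        proof -
          have "f k \<in> ?X" by (rule subsetD[OF conjunct2[OF f] rangeI])
          then obtain i j where "f k = (i, j)" "i < j" by auto
          then show ?thesis by (simp add: u'_def)
        qed
        then show "det (\<chi> k. (\<lambda>(i, j). u' i j) (f k)) \<noteq> 0"
          using u(1) f unfolding generic_vectors_def by simp
      qed
      then obtain f g where fg: "norm f = 1" "norm g = 1" "f \<bullet> g = 0"
        "c * real n \<le> real (card {i. i < n \<and> pencil_hits f g (u' i ` ?J i)})"
        using generic n s by blast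
      have "norm (u' i j - v i j) \<le> 1 / real (Suc k)" if "i < n" "j < n" "i \<noteq> j" for i j
      proof (cases "i < j")
        case True
        then show ?thesis using u(2)[of "(i, j)"] that by (simp add: u'_def)
      next
        case False
        then show ?thesis using u(2)[of "(j, i)"] that sym[rule_format, of i j] by (simp add: u'_def)
      qed
      then have "Q k f g u'" using fg by (simp add: Q_def)
      then show ?thesis by blast
    qed
    then obtain f g u where "\<And>k. Q k (f k) (g k) (u k)" by metis
    then have fgu: "\<And>k. norm (f k) = 1" "\<And>k. norm (g k) = 1" "\<And>k. f k \<bullet> g k = 0"
      "\<And>k i j. \<lbrakk>i < n; j < n; i \<noteq> j\<rbrakk> \<Longrightarrow> norm (u k i j - v i j) \<le> 1 / real (Suc k)"
      "\<And>k. c * real n \<le> real (card {i. i < n \<and> pencil_hits (f k) (g k) (u k i ` ?J i)})"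
      by (simp_all add: Q_def)
    have "compact (sphere (0::real^4) 1 \<times> sphere (0::real^4) 1)"
      by (intro compact_Times compact_sphere)
    moreover have "\<forall>k. (f k, g k) \<in> sphere 0 1 \<times> sphere 0 1" using fgu by simp
    ultimately obtain l r where l: "l \<in> sphere 0 1 \<times> sphere 0 1" "strict_mono (r :: nat \<Rightarrow> nat)"
      "((\<lambda>k. (f k, g k)) \<circ> r) \<longlonglongrightarrow> l"
      by (rule seq_compactE[OF compact_imp_seq_compact])
    define F where "F = fst l"
    define H where "H = snd l"
    have lim: "(\<lambda>k. f (r k)) \<longlonglongrightarrow> F" "(\<lambda>k. g (r k)) \<longlonglongrightarrow> H"
      using tendsto_fst[OF l(3)] tendsto_snd[OF l(3)] by (simp_all add: F_def H_def o_def)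
    have FH: "norm F = 1" "norm H = 1" using l(1) by (auto simp: F_def H_def)
    have "(\<lambda>k. f (r k) \<bullet> g (r k)) \<longlonglongrightarrow> F \<bullet> H" by (intro tendsto_inner lim)
    then have "F \<bullet> H = 0" using fgu(3) by (simp add: LIMSEQ_const_iff)
    define S where "S k = {i. i < n \<and> pencil_hits (f (r k)) (g (r k)) (u (r k) i ` ?J i)}" for k
    have "finite (range S)" by (rule finite_subset[of _ "Pow {..<n}"]) (auto simp: S_def)
    then obtain k0 where inf: "infinite {k. S k = S k0}"
      using pigeonhole_infinite[of UNIV S] by auto
    have "S k0 \<subseteq> {i. i < n \<and> pencil_hits F H (v i ` ?J i)}"
    proof
      fix i assume i: "i \<in> S k0"
      then have "i < n" by (simp add: S_def)
      let ?K = "convex hull (v i ` ?J i)"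
      \<comment> \<open>It vanishes exactly on the limiting subspace, so it suffices that its
        minimum over the hull is zero.\<close>
      let ?\<phi> = "\<lambda>z. \<bar>z \<bullet> F\<bar> + \<bar>z \<bullet> H\<bar>"
      have K: "compact ?K" by (intro finite_imp_compact_convex_hull) simp
      have "1 \<in> ?J i \<or> 0 \<in> ?J i" using n by auto
      then have "?K \<noteq> {}" by auto
      moreover have "continuous_on ?K ?\<phi>" by (intro continuous_intros)
      ultimately obtain z where z: "z \<in> ?K" "\<And>y. y \<in> ?K \<Longrightarrow> ?\<phi> z \<le> ?\<phi> y"
        using continuous_attains_inf[OF K, of ?\<phi>] by blast
      obtain b where b: "\<And>y. y \<in> ?K \<Longrightarrow> norm y \<le> b"
        using compact_imp_bounded[OF K] bounded_iff by blast
      have "?\<phi> z = 0"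
      proof (rule ccontr)
        assume "?\<phi> z \<noteq> 0"
        then have pos: "?\<phi> z > 0" by (smt (verit) abs_ge_zero)
        \<comment> \<open>The first term pays for moving \<open>y\<close> to \<open>y'\<close> under
          both functionals, the second for replacing the functionals by their limits;
          \<open>b + 1\<close> bounds the norm of \<open>y\<close>.\<close>
        let ?e = "\<lambda>k. 2 / real (Suc (r k)) + (b + 1) * (norm (F - f (r k)) + norm (H - g (r k)))"
        have "(\<lambda>k. 2 / real (Suc (r k))) \<longlonglongrightarrow> 0"
          using LIMSEQ_subseq_LIMSEQ[OF LIMSEQ_Suc[OF lim_const_over_n[of 2]] l(2)] by (simp add: o_def)
        then have "?e \<longlonglongrightarrow> 0 + (b + 1) * (norm (F - F) + norm (H - H))"
          by (intro tendsto_intros lim)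
        then have "?e \<longlonglongrightarrow> 0" by simp
        then have "\<forall>\<^sub>F k in sequentially. ?e k < ?\<phi> z" using pos by (rule order_tendstoD(2))
        then obtain k1 where k1: "\<And>k. k \<ge> k1 \<Longrightarrow> ?e k < ?\<phi> z"
          unfolding eventually_sequentially by blast
        obtain k where k: "k \<ge> k1" "S k = S k0"
          using inf unfolding infinite_nat_iff_unbounded_le by blast
        then have "pencil_hits (f (r k)) (g (r k)) (u (r k) i ` ?J i)"
          using i by (auto simp: S_def)
        then obtain y where y: "y \<in> convex hull (u (r k) i ` ?J i)" "y \<bullet> f (r k) = 0" "y \<bullet> g (r k) = 0"
          unfolding pencil_hits_def by blast
        obtain y' where y': "y' \<in> ?K" "norm (y - y') \<le> 1 / real (Suc (r k))"
          by (rule convex_hull_perturbation[OF y(1), of "v i" "1 / real (Suc (r k))"])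
             (use fgu(4) \<open>i < n\<close> in auto)
        have "1 / real (Suc (r k)) \<le> 1" by simp
        moreover have "norm y \<le> norm y' + norm (y - y')"
          using norm_triangle_ineq[of y' "y - y'"] by simp
        ultimately have ny: "norm y \<le> b + 1"
          using b[OF y'(1)] y'(2) by linarith
        have est: "\<bar>y' \<bullet> P\<bar> \<le> 1 / real (Suc (r k)) + (b + 1) * norm (P - q)" if "norm P = 1" "y \<bullet> q = 0" for P q
        proof -
          have "y' \<bullet> P = y \<bullet> (P - q) - (y - y') \<bullet> P"
            using that(2) by (simp add: inner_diff_left inner_diff_right)
          moreover have "\<bar>y \<bullet> (P - q)\<bar> \<le> (b + 1) * norm (P - q)"
            using Cauchy_Schwarz_ineq2[of y "P - q"] mult_right_mono[OF ny, of "norm (P - q)"] by simp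
          moreover have "\<bar>(y - y') \<bullet> P\<bar> \<le> 1 / real (Suc (r k))"
            using Cauchy_Schwarz_ineq2[of "y - y'" P] y'(2) that(1) by simp
          ultimately show ?thesis by linarith
        qed
        have "?\<phi> y' \<le> ?e k"
          using est[OF FH(1) y(2)] est[OF FH(2) y(3)] by (simp add: algebra_simps)
        then show False using k1[OF k(1)] z(2)[OF y'(1)] by linarith
      qed
      then have "z \<bullet> F = 0" "z \<bullet> H = 0" by (smt (verit) abs_ge_zero abs_zero)+
      then show "i \<in> {i. i < n \<and> pencil_hits F H (v i ` ?J i)}"
        using z(1) \<open>i < n\<close> unfolding pencil_hits_def by blast
    qed
    then have "card (S k0) \<le> card {i. i < n \<and> pencil_hits F H (v i ` ?J i)}"
      by (intro card_mono) auto
    then have "c * real n \<le> real (card {i. i < n \<and> pencil_hits F H (v i ` ?J i)})"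
      using fgu(5)[of "r k0"] unfolding S_def by linarith
    then show "\<exists>f g. norm f = 1 \<and> norm g = 1 \<and> f \<bullet> g = 0
            \<and> c * real n \<le> real (card {i. i < n \<and> pencil_hits f g (v i ` ?J i)})"
      using FH \<open>F \<bullet> H = 0\<close> by blast
  qed
qed

subsection \<open>Lines in space\<close>

text \<open>The affine chart with last coordinate 1, in which affine equations on space become
  linear ones.\<close>

definition homogenize :: "real^3 \<Rightarrow> real^4" where
  "homogenize p = (\<chi> k. if k = 1 then p $ 1 else if k = 2 then p $ 2 else if k = 3 then p $ 3 else 1)"

lemma convex_homogenize_image:
  assumes "convex C"
  shows "convex (homogenize ` C)"
proof (rule convexI)
  fix x y and u v :: real
  assume "x \<in> homogenize ` C" "y \<in> homogenize ` C" and uv: "0 \<le> u" "0 \<le> v" "u + v = 1"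
  then obtain p q where pq: "p \<in> C" "q \<in> C" "x = homogenize p" "y = homogenize q" by blast
  have "u *\<^sub>R x + v *\<^sub>R y = homogenize (u *\<^sub>R p + v *\<^sub>R q)"
    using uv(3) by (simp add: pq(3,4) vec_eq_iff homogenize_def)
  moreover have "u *\<^sub>R p + v *\<^sub>R q \<in> C"
    using assms pq uv by (simp add: convexD)
  ultimately show "u *\<^sub>R x + v *\<^sub>R y \<in> homogenize ` C" by blast
qed

text \<open>A two-dimensional subspace may correspond to a line at infinity; the point
  \<open>y0\<close> excludes this. The two planes then have independent normals, whose cross product
  is the direction.\<close>

lemma line_of_pencil:
  assumes fg: "norm f = 1" "norm g = 1" "f \<bullet> g = 0"
    and y0: "homogenize y0 \<bullet> f = 0" "homogenize y0 \<bullet> g = 0"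
  obtains L where "affine L" "aff_dim L = 1"
    "\<And>y. \<lbrakk>homogenize y \<bullet> f = 0; homogenize y \<bullet> g = 0\<rbrakk> \<Longrightarrow> y \<in> L"
proof -
  define tr :: "real^4 \<Rightarrow> real^3" where "tr h = (\<chi> k. if k = 1 then h $ 1 else if k = 2 then h $ 2 else h $ 3)" for h
  have tr: "tr h $ 1 = h $ 1" "tr h $ 2 = h $ 2" "tr h $ 3 = h $ 3" for h by (simp_all add: tr_def)
  have inner: "homogenize y \<bullet> h = y \<bullet> tr h + h $ 4" for y h
    by (simp add: homogenize_def inner_vec_def sum_4 sum_3 tr)
  \<comment> \<open>A functional with zero linear part is constant on the chart, so vanishing at
    \<open>y0\<close> makes it zero. This rules out parallel normals.\<close>
  have ext: "h = 0" if "tr h = 0" "homogenize y0 \<bullet> h = 0" for h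
  proof -
    have "h $ 1 = 0" "h $ 2 = 0" "h $ 3 = 0"
      unfolding tr(1)[of h, symmetric] tr(2)[of h, symmetric] tr(3)[of h, symmetric] by (simp_all add: that(1))
    moreover have "h $ 4 = 0" using that by (simp add: inner)
    ultimately show ?thesis by (simp add: vec_eq_iff forall_4)
  qed
  have tr_diff: "tr (h - c *\<^sub>R k) = tr h - c *\<^sub>R tr k" for h k c
    by (simp add: vec_eq_iff forall_3 tr)
  define d where "d = cross3 (tr f) (tr g)"
  have "d \<noteq> 0"
  proof
    assume "d = 0"
    then have "collinear {0, tr f, tr g}" by (simp add: d_def cross_eq_0)
    then consider "tr f = 0" | "tr g = 0" | c where "tr g = c *\<^sub>R tr f"
      unfolding collinear_lemma by blast
    then show False
    proof cases
      case 1
      then show False using ext[of f] y0 fg by auto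
    next
      case 2
      then show False using ext[of g] y0 fg by auto
    next
      case (3 c)
      then have "g - c *\<^sub>R f = 0"
        using y0 by (intro ext) (simp_all add: tr_diff inner_diff_right)
      then have "g = c *\<^sub>R f" by simp
      then have "c = 0" using fg by (simp add: dot_square_norm)
      then show False using \<open>g = c *\<^sub>R f\<close> fg(2) by simp
    qed
  qed
  show ?thesis
  proof (rule that[of "affine hull {y0, y0 + d}"])
    show "affine (affine hull {y0, y0 + d})" by (rule affine_affine_hull)
    show "aff_dim (affine hull {y0, y0 + d}) = 1"
      using \<open>d \<noteq> 0\<close> by (simp add: aff_dim_2)
    fix y assume y: "homogenize y \<bullet> f = 0" "homogenize y \<bullet> g = 0"
    have "(y - y0) \<bullet> tr f = 0" "(y - y0) \<bullet> tr g = 0"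
      using y y0 unfolding inner by (simp_all add: inner_diff_left)
    then have "cross3 (y - y0) d = 0" by (simp add: d_def Lagrange)
    then have "collinear {0, d, y - y0}" by (simp add: cross_eq_0 insert_commute)
    then obtain c where "y - y0 = c *\<^sub>R d"
      using \<open>d \<noteq> 0\<close> unfolding collinear_lemma by (metis scaleR_zero_left)
    then have "y = (1 - c) *\<^sub>R y0 + c *\<^sub>R (y0 + d)" by (simp add: algebra_simps)
    then show "y \<in> affine hull {y0, y0 + d}"
      unfolding affine_hull_2 by force
  qed
qed

theorem theorem1p8:
  "\<exists>c::real. c > 0 \<and>
     (\<forall>n::nat. n \<ge> 1 \<longrightarrow>
       (\<forall>\<K> :: (real ^ 3) set set.
          finite \<K> \<and> card \<K> = n \<and>
          (\<forall>K\<in>\<K>. convex K) \<and>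
          (\<forall>K\<^sub>1\<in>\<K>. \<forall>K\<^sub>2\<in>\<K>. K\<^sub>1 \<inter> K\<^sub>2 \<noteq> {})
          \<longrightarrow> (\<exists>L :: (real ^ 3) set. affine L \<and> aff_dim L = 1 \<and>
                 real (card {K \<in> \<K>. K \<inter> L \<noteq> {}}) \<ge> c * real n)))"
proof -
  obtain c :: real where c: "c > 0"
    and fraction: "\<forall>n v. 1000 \<le> n \<longrightarrow> (\<forall>i j. v i j = v j i)
      \<longrightarrow> (\<exists>f g. norm f = 1 \<and> norm g = 1 \<and> f \<bullet> g = 0
            \<and> c * real n \<le> real (card {i. i < n \<and> pencil_hits f g (v i ` ({..<n} - {i}))}))"
    using positive_fraction by (elim exE conjE) (rule that)
  \<comment> \<open>The bound \<open>1 / 1000\<close> settles \<open>n < 1000\<close>, where a line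
    through a point of one set suffices.\<close>
  define c' where "c' = min c (1 / 1000)"
  have c': "c' > 0" using c by (simp add: c'_def)
  show ?thesis
  proof (intro exI[of _ c'] conjI c' allI impI)
    fix n :: nat and \<K> :: "(real^3) set set"
    assume n: "1 \<le> n" and "finite \<K> \<and> card \<K> = n \<and> (\<forall>K\<in>\<K>. convex K) \<and> (\<forall>K\<^sub>1\<in>\<K>. \<forall>K\<^sub>2\<in>\<K>. K\<^sub>1 \<inter> K\<^sub>2 \<noteq> {})"
    then have \<K>: "finite \<K>" "card \<K> = n" and conv: "\<And>K. K \<in> \<K> \<Longrightarrow> convex K"
      and meet: "\<And>K\<^sub>1 K\<^sub>2. K\<^sub>1 \<in> \<K> \<Longrightarrow> K\<^sub>2 \<in> \<K> \<Longrightarrow> K\<^sub>1 \<inter> K\<^sub>2 \<noteq> {}" by auto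
    show "\<exists>L. affine L \<and> aff_dim L = 1 \<and> c' * real n \<le> real (card {K \<in> \<K>. K \<inter> L \<noteq> {}})"
    proof (cases "n < 1000")
      case True
      have "\<K> \<noteq> {}" using \<K> n by auto
      then obtain K where K: "K \<in> \<K>" by blast
      then obtain x where x: "x \<in> K" using meet[of K K] by blast
      let ?L = "affine hull {x, x + axis 1 1}"
      have "x \<in> ?L" by (simp add: hull_inc)
      then have "K \<in> {K \<in> \<K>. K \<inter> ?L \<noteq> {}}" using K x by blast
      then have "card {K \<in> \<K>. K \<inter> ?L \<noteq> {}} \<noteq> 0" using \<K>(1) by auto
      moreover have "c' * real n \<le> 1 / 1000 * 1000"
        using True c' by (intro mult_mono) (auto simp: c'_def)
      ultimately have "c' * real n \<le> real (card {K \<in> \<K>. K \<inter> ?L \<noteq> {}})" by simp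
      moreover have "aff_dim ?L = 1" by (simp add: aff_dim_2 axis_eq_0_iff)
      ultimately show ?thesis using affine_affine_hull by blast
    next
      case False
      obtain h where h: "bij_betw h {..<n} \<K>"
        using \<K> finite_same_card_bij[of "{..<n}" \<K>] by auto
      have h_in: "h i \<in> \<K>" if "i < n" for i
        using bij_betwE[OF h] that by blast
      \<comment> \<open>The choice depends only on the intersection, so \<open>p\<close> is
        symmetric by commutativity.\<close>
      define p where "p i j = (SOME x. x \<in> h i \<inter> h j)" for i j
      have p: "p i j \<in> h i" if "i < n" "j < n" for i j
      proof -
        have "\<exists>x. x \<in> h i \<inter> h j" using meet h_in that by blast
        then show ?thesis unfolding p_def by (metis (mono_tags, lifting) IntD1 someI_ex)
      qed
      have "\<forall>i j. homogenize (p i j) = homogenize (p j i)" by (simp add: p_def Int_commute)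
      then obtain f g where fg: "norm f = 1" "norm g = 1" "f \<bullet> g = 0"
        and many: "c * real n \<le> real (card {i. i < n \<and> pencil_hits f g ((\<lambda>j. homogenize (p i j)) ` ({..<n} - {i}))})"
        using fraction[rule_format, of n "\<lambda>i j. homogenize (p i j)"] False by auto
      define S where "S = {i. i < n \<and> pencil_hits f g ((\<lambda>j. homogenize (p i j)) ` ({..<n} - {i}))}"
      have hit: "\<exists>y\<in>h i. homogenize y \<bullet> f = 0 \<and> homogenize y \<bullet> g = 0" if "i \<in> S" for i
      proof -
        have i: "i < n" and "pencil_hits f g ((\<lambda>j. homogenize (p i j)) ` ({..<n} - {i}))"
          using that by (simp_all add: S_def)
        then obtain z where z: "z \<in> convex hull ((\<lambda>j. homogenize (p i j)) ` ({..<n} - {i}))" "z \<bullet> f = 0" "z \<bullet> g = 0"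
          unfolding pencil_hits_def by blast
        have "convex hull ((\<lambda>j. homogenize (p i j)) ` ({..<n} - {i})) \<subseteq> homogenize ` h i"
          using p[OF i] by (intro hull_minimal convex_homogenize_image conv h_in i) auto
        then show ?thesis using z by blast
      qed
      \<comment> \<open>At least one set is hit, which provides the finite point demanded by
        \<open>line_of_pencil\<close>.\<close>
      have "c * real n > 0" using c n by simp
      then have "S \<noteq> {}" using many by (auto simp: S_def[symmetric])
      then obtain y0 where "homogenize y0 \<bullet> f = 0" "homogenize y0 \<bullet> g = 0"
        using hit by blast
      then obtain L where L: "affine L" "aff_dim L = 1"
        and on_L: "\<And>y. \<lbrakk>homogenize y \<bullet> f = 0; homogenize y \<bullet> g = 0\<rbrakk> \<Longrightarrow> y \<in> L"
        by (rule line_of_pencil[OF fg]) (rule that, assumption, assumption, blast)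
      have "h ` S \<subseteq> {K \<in> \<K>. K \<inter> L \<noteq> {}}"
        using hit on_L h_in unfolding S_def by blast
      then have "card (h ` S) \<le> card {K \<in> \<K>. K \<inter> L \<noteq> {}}"
        using \<K>(1) by (intro card_mono) auto
      moreover have "inj_on h S"
        by (rule inj_on_subset[OF bij_betw_imp_inj_on[OF h]]) (auto simp: S_def)
      then have "card (h ` S) = card S" by (rule card_image)
      moreover have "c' * real n \<le> c * real n"
        by (intro mult_right_mono) (simp_all add: c'_def)
      ultimately have "c' * real n \<le> real (card {K \<in> \<K>. K \<inter> L \<noteq> {}})"
        using many unfolding S_def[symmetric] by linarith
      then show ?thesis using L by blast
    qed
  qed
qed

end
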